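(* Consider the network error recursion $$\tilde{\boldsymbol w}_i=\boldsymbol{\mathcal B}_{i-1}\tilde{\boldsymbol w}_{i-1}+\mathcal A^{\mathsf T}\mathcal M\,\boldsymbol s_i(\boldsymbol w_{i-1}),\qquad i\ge 0,$$ associated with the group-wise adapt-then-combine diffusion strategy described in the context. For sufficiently small step-sizes it is mean-square and mean-fourth-order stable in the sense that $$\limsup_{i\to\infty}\mathbb E\|\tilde{\boldsymbol w}_i\|^2=O(\mu_{\max}),\qquad \limsup_{i\to\infty}\mathbb E\|\tilde{\boldsymbol w}_i\|^4=O(\mu_{\max}^2).$$ That is, there exist constants $\mu_0>0$ and $C>0$, independent of $\mu_{\max}$, such that for all $0<\mu_{\max}\le\mu_0$ the two limits superior are at most $C\mu_{\max}$ and $C\mu_{\max}^2$, respectively.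
   Context: **Network.** There are $N$ agents; agent $k$ has a neighborhood $\mathcal N_k\ni k$ and a cost $J_k:\mathbb R^{M}\to\mathbb R$ with unique minimizer $w_k^o$. Agents are partitioned into $Q\ge 2$ clusters $\mathcal C_1,\dots,\mathcal C_Q$; all agents in $\mathcal C_q$ share the same minimizer $w_k^o=w_q^\star$. Agents are further partitioned into $G$ groups $\mathcal G_1,\dots,\mathcal G_G$; each group $\mathcal G_m$ is contained in a single cluster, has $N_m^g$ agents, and is connected (any agent of the group is reachable from any other through links inside the group). Agents are indexed so that agents of the same group are consecutive, and groups of the same cluster are consecutive. **Combination matrix.** $A=[a_{\ell k}]_{\ell,k=1}^N$ with, for $k\in\mathcal G_m$, $a_{\ell k}>0$ if $\ell\in\mathcal N_k\cap\mathcal G_m$, $a_{\ell k}=0$ otherwise, and $\sum_\ell a_{\ell k}=1$. Thus $A=\mathrm{diag}\{A_1,\dots,A_G\}$ with each $A_m$ left-stochastic and primitive. **Step-sizes.** $\mu_k>0$, $\mu_{\max}=\max_k\mu_k$; $\mu_k=\tau_k\mu_{\max}$ with $\tau_k\in(0,1]$ fixed, and $\mu_{\max}$ is the small parameter. All constants in $O(\cdot)$ are independent of $\mu_{\max}$. **Algorithm.** With $\boldsymbol w_{k,-1}=0$, for $i\ge 0$ and $k\in\mathcal G_m$: $$\boldsymbol\psi_{k,i}=\boldsymbol w_{k,i-1}-\mu_k\widehat{\nabla J_k}(\boldsymbol w_{k,i-1}),\qquad \boldsymbol w_{k,i}=\sum_{\ell\in\mathcal N_k\cap\mathcal G_m}a_{\ell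 k}\boldsymbol\psi_{\ell,i},$$ where $\widehat{\nabla J_k}$ is a stochastic approximation of $\nabla J_k$ (at iteration $i$). Stacked vectors: $\boldsymbol w_i=\mathrm{col}\{\boldsymbol w_{1,i},\dots,\boldsymbol w_{N,i}\}\in\mathbb R^{NM}$, $w^o=\mathrm{col}\{w_1^o,\dots,w_N^o\}$, $\tilde{\boldsymbol w}_i=w^o-\boldsymbol w_i$, with individual errors $\tilde{\boldsymbol w}_{k,i}=w_k^o-\boldsymbol w_{k,i}$. Gradient noise: $\boldsymbol s_{k,i}(\boldsymbol w_{k,i-1})=\widehat{\nabla J_k}(\boldsymbol w_{k,i-1})-\nabla J_k(\boldsymbol w_{k,i-1})$, $\boldsymbol s_i(\boldsymbol w_{i-1})=\mathrm{col}\{\boldsymbol s_{1,i}(\boldsymbol w_{1,i-1}),\dots,\boldsymbol s_{N,i}(\boldsymbol w_{N,i-1})\}$. Put $\mathcal A=A\otimes I_M$, $\mathcal M=\mathrm{diag}\{\mu_1,\dots,\mu_N\}\otimes I_M$, $\boldsymbol H_{k,i-1}=\int_0^1\nabla^2J_k(w_k^o-t\tilde{\boldsymbol w}_{k,i-1})dt$, $\boldsymbol{\mathcal H}_{i-1}=\mathrm{diag}\{\boldsymbol H_{1,i-1},\dots,\boldsymbol H_{N,i-1}\}$, $\boldsymbol{\mathcal B}_{i-1}=\mathcal A^{\mathsf T}(I_{NM}-\mathcal M\boldsymbol{\mathcal H}_{i-1})$. **Assumptions on costs.** Each $J_k$ is strictly convex, twice differentiable, with $\lambda_{k,L}I_M\le\nabla^2J_k(w)\le\lambda_{k,U}I_M$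 for all $w$, $0\le\lambda_{k,L}\le\lambda_{k,U}<\infty$; in each group at least one cost has $\lambda_{k,L}>0$. For $w=\mathrm{col}\{w_1,\dots,w_N\}$ the matrix $\nabla^2J(w)=\mathrm{diag}\{\nabla^2J_1(w_1),\dots,\nabla^2J_N(w_N)\}$ satisfies $\|\nabla^2J(x)-\nabla^2J(y)\|\le\kappa_H\|x-y\|$ for all $x,y\in\mathbb R^{NM}$, some $\kappa_H\ge 0$. **Assumptions on gradient noise.** There is a filtration $\{\mathbb F_i\}$ (information up to iteration $i$; $\boldsymbol w_i$ is $\mathbb F_i$-measurable) such that for every $\mathbb F_{i-1}$-measurable $\boldsymbol w_{i-1}$, with $\mathcal R_{s,i}(\boldsymbol w_{i-1})=\mathbb E[\boldsymbol s_i(\boldsymbol w_{i-1})\boldsymbol s_i(\boldsymbol w_{i-1})^{\mathsf T}|\mathbb F_{i-1}]$: (1) $\mathbb E[\boldsymbol s_i(\boldsymbol w_{i-1})|\mathbb F_{i-1}]=0$; (2) $\mathbb E[\|\boldsymbol s_i(\boldsymbol w_{i-1})\|^4|\mathbb F_{i-1}]\le\alpha^2\|w^o-\boldsymbol w_{i-1}\|^4+\sigma_s^4$ for some $\alpha,\sigma_s\ge0$; (3) $\|\mathcal R_{s,i}(w^o)-\mathcal R_{s,i}(\boldsymbol w_{i-1})\|\le\kappa_s\|w^o-\boldsymbol w_{i-1}\|^{\gamma_s}$ for some $\kappa_s\ge0$, $0<\gamma_s\le4$; (4) $\lim_{i\to\infty}\mathcal R_{s,i}(w^o)=\mathcal R_s$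 (almost surely), a deterministic symmetric positive definite matrix. These constants and $\mathcal R_s$ do not depend on the step-sizes. Norms are Euclidean for vectors and the induced 2-norm for matrices. *)

theory Defs
  imports "HOL-Probability.Probability"
begin

section \<open>Block vectors and matrices\<close>

text \<open>
  Agents are indexed by a finite type \<open>'n\<close>, coordinates by a finite type \<open>'m\<close>. A stacked vector is
  indexed by pairs (agent, coordinate), so its \<^const>\<open>norm\<close> is the Euclidean norm on
  the space of dimension \<open>CARD('n) * CARD('m)\<close>.
\<close>

definition col :: "('n::finite \<Rightarrow> real^'m::finite) \<Rightarrow> real^('n \<times> 'm)" where
  "col v = (\<chi> p. v (fst p) $ snd p)"

definition block :: "'n::finite \<Rightarrow> real^('n \<times> 'm::finite) \<Rightarrow> real^'m" where
  "block k x = (\<chi> j. x $ (k, j))"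

definition block_diag ::
  "('n::finite \<Rightarrow> real^'m::finite^'m) \<Rightarrow> real^('n \<times> 'm)^('n \<times> 'm)" where
  "block_diag D = (\<chi> p q. if fst p = fst q then D (fst p) $ snd p $ snd q else 0)"

definition kron ::
  "real^'n::finite^'n \<Rightarrow> real^'m::finite^'m \<Rightarrow> real^('n \<times> 'm)^('n \<times> 'm)" where
  "kron X Y = (\<chi> p q. X $ fst p $ fst q * Y $ snd p $ snd q)"

definition diag :: "('n::finite \<Rightarrow> real) \<Rightarrow> real^'n^'n" where
  "diag d = (\<chi> i j. if i = j then d i else 0)"

definition mat_norm :: "real^'n::finite^'n \<Rightarrow> real" where
  "mat_norm X = onorm ((*v) X)"

definition pos_semidef :: "real^'n::finite^'n \<Rightarrow> bool" where
  "pos_semidef X \<longleftrightarrow> transpose X = X \<and> (\<forall>v. 0 \<le> v \<bullet> (X *v v))"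

definition pos_def :: "real^'n::finite^'n \<Rightarrow> bool" where
  "pos_def X \<longleftrightarrow> transpose X = X \<and> (\<forall>v. v \<noteq> 0 \<longrightarrow> 0 < v \<bullet> (X *v v))"

definition loewner_le :: "real^'n::finite^'n \<Rightarrow> real^'n^'n \<Rightarrow> bool" where
  "loewner_le X Y \<longleftrightarrow> pos_semidef (Y - X)"


section \<open>Costs\<close>

definition gradient :: "(real^'m::finite \<Rightarrow> real) \<Rightarrow> real^'m \<Rightarrow> real^'m" where
  "gradient f x = (THE g. GDERIV f x :> g)"

definition hessian :: "(real^'m::finite \<Rightarrow> real) \<Rightarrow> real^'m \<Rightarrow> real^'m^'m" where
  "hessian f x = jacobian (gradient f) (at x)"

definition twice_differentiable :: "(real^'m::finite \<Rightarrow> real) \<Rightarrow> bool" where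
  "twice_differentiable f \<longleftrightarrow>
     f differentiable_on UNIV \<and> gradient f differentiable_on UNIV"

definition strictly_convex :: "('a::real_vector \<Rightarrow> real) \<Rightarrow> bool" where
  "strictly_convex f \<longleftrightarrow>
     (\<forall>x y t. x \<noteq> y \<and> 0 < t \<and> t < 1 \<longrightarrow>
        f ((1 - t) *\<^sub>R x + t *\<^sub>R y) < (1 - t) * f x + t * f y)"

definition unique_minimizer :: "('a \<Rightarrow> real) \<Rightarrow> 'a \<Rightarrow> bool" where
  "unique_minimizer f x \<longleftrightarrow> (\<forall>y. is_arg_min f (\<lambda>_. True) y \<longleftrightarrow> y = x)"

locale cost_model =
  fixes clusters groups :: "'n::finite set set"
    and J :: "'n \<Rightarrow> real^'m::finite \<Rightarrow> real"
    and wo :: "'n \<Rightarrow> real^'m"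
    and lamL lamU :: "'n \<Rightarrow> real"
    and kappaH :: real
  assumes minimizer: "\<And>k. unique_minimizer (J k) (wo k)"
    and cluster_minimizer: "\<And>c k l. c \<in> clusters \<Longrightarrow> k \<in> c \<Longrightarrow> l \<in> c \<Longrightarrow> wo k = wo l"
    and strictly_convex: "\<And>k. strictly_convex (J k)"
    and twice_diff: "\<And>k. twice_differentiable (J k)"
    and lam_bounds: "\<And>k. 0 \<le> lamL k \<and> lamL k \<le> lamU k"
    and hessian_lower: "\<And>k w. loewner_le (mat (lamL k)) (hessian (J k) w)"
    and hessian_upper: "\<And>k w. loewner_le (hessian (J k) w) (mat (lamU k))"
    and group_strong: "\<And>g. g \<in> groups \<Longrightarrow> \<exists>k\<in>g. 0 < lamL k"
    and kappaH_nonneg: "0 \<le> kappaH"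
    and hessian_lipschitz:
      "\<And>x y :: real^('n \<times> 'm).
         mat_norm (block_diag (\<lambda>k. hessian (J k) (block k x))
                   - block_diag (\<lambda>k. hessian (J k) (block k y))) \<le> kappaH * norm (x - y)"


section \<open>Network\<close>

definition consecutive :: "'n::linorder set \<Rightarrow> bool" where
  "consecutive S \<longleftrightarrow> (\<forall>i\<in>S. \<forall>k\<in>S. {i..k} \<subseteq> S)"

text \<open>
  Links may be directed: \<open>l \<in> nbhd k\<close> means that agent \<open>k\<close> receives from agent \<open>l\<close>. Since every
  group lies in one cluster, clusters are unions of groups, and consecutiveness of the groups of a
  cluster amounts to consecutiveness of the cluster itself.
\<close>

locale clustered_network =
  fixes nbhd :: "'n::{finite,linorder} \<Rightarrow> 'n set"
    and clusters groups :: "'n set set"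
  assumes nbhd_self: "\<And>k. k \<in> nbhd k"
    and clusters: "partition_on UNIV clusters"
    and two_clusters: "2 \<le> card clusters"
    and groups: "partition_on UNIV groups"
    and group_in_cluster: "\<And>g. g \<in> groups \<Longrightarrow> \<exists>c\<in>clusters. g \<subseteq> c"
    and group_connected:
      "\<And>g k l. g \<in> groups \<Longrightarrow> k \<in> g \<Longrightarrow> l \<in> g \<Longrightarrow>
         (k, l) \<in> {(a, b). a \<in> g \<and> b \<in> g \<and> a \<in> nbhd b}\<^sup>*"
    and group_consecutive: "\<And>g. g \<in> groups \<Longrightarrow> consecutive g"
    and cluster_consecutive: "\<And>c. c \<in> clusters \<Longrightarrow> consecutive c"

definition group_of :: "'n set set \<Rightarrow> 'n \<Rightarrow> 'n set" where
  "group_of groups k = (THE g. g \<in> groups \<and> k \<in> g)"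

locale combination_matrix =
  fixes nbhd :: "'n::finite \<Rightarrow> 'n set"
    and groups :: "'n set set"
    and A :: "real^'n^'n"
  assumes weight_pos: "\<And>k l. l \<in> nbhd k \<inter> group_of groups k \<Longrightarrow> 0 < A $ l $ k"
    and weight_zero: "\<And>k l. l \<notin> nbhd k \<inter> group_of groups k \<Longrightarrow> A $ l $ k = 0"
    and left_stochastic: "\<And>k. (\<Sum>l\<in>UNIV. A $ l $ k) = 1"


section \<open>Gradient noise\<close>

text \<open>
  \<open>ghat k i \<omega> w\<close> is the stochastic approximation of the gradient of \<open>J k\<close> at \<open>w\<close> used in iteration \<open>i\<close>.
\<close>

definition grad_noise ::
  "('n::finite \<Rightarrow> real^'m::finite \<Rightarrow> real) \<Rightarrow> ('n \<Rightarrow> nat \<Rightarrow> 'a \<Rightarrow> real^'m \<Rightarrow> real^'m)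
     \<Rightarrow> nat \<Rightarrow> 'a \<Rightarrow> real^('n \<times> 'm) \<Rightarrow> real^('n \<times> 'm)" where
  "grad_noise J ghat i \<omega> w =
     col (\<lambda>k. ghat k i \<omega> (block k w) - gradient (J k) (block k w))"

definition cond_mean ::
  "'a measure \<Rightarrow> 'a measure \<Rightarrow> ('a \<Rightarrow> real^'p::finite) \<Rightarrow> 'a \<Rightarrow> real^'p" where
  "cond_mean M G X \<omega> = (\<chi> p. real_cond_exp M G (\<lambda>\<omega>. X \<omega> $ p) \<omega>)"

definition cond_second_moment ::
  "'a measure \<Rightarrow> 'a measure \<Rightarrow> ('a \<Rightarrow> real^'p::finite) \<Rightarrow> 'a \<Rightarrow> real^'p^'p" where
  "cond_second_moment M G X \<omega> = (\<chi> p q. real_cond_exp M G (\<lambda>\<omega>. X \<omega> $ p * X \<omega> $ q) \<omega>)"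

text \<open>
  The time index of the filtration is shifted by one: \<open>F i\<close> is the information available before
  iteration \<open>i\<close>, usually written with index \<open>i - 1\<close>. The fourth-moment bound uses
  \<^const>\<open>nn_cond_exp\<close>, so that it also asserts finiteness.
\<close>

locale gradient_noise = prob_space M + filtration "space M" F
  for M :: "'a measure" and F :: "nat \<Rightarrow> 'a measure" +
  fixes J :: "'n::finite \<Rightarrow> real^'m::finite \<Rightarrow> real"
    and wo :: "'n \<Rightarrow> real^'m"
    and ghat :: "'n \<Rightarrow> nat \<Rightarrow> 'a \<Rightarrow> real^'m \<Rightarrow> real^'m"
    and alpha sigma kappaS gammaS :: real
    and Rs :: "real^('n \<times> 'm)^('n \<times> 'm)"
  assumes subalg: "\<And>i. subalgebra M (F i)"
    and noise_measurable:
      "\<And>i w. w \<in> borel_measurable (F i) \<Longrightarrow>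
         (\<lambda>\<omega>. grad_noise J ghat i \<omega> (w \<omega>)) \<in> borel_measurable M"
    and noise_mean:
      "\<And>i w. w \<in> borel_measurable (F i) \<Longrightarrow>
         AE \<omega> in M. cond_mean M (F i) (\<lambda>\<omega>. grad_noise J ghat i \<omega> (w \<omega>)) \<omega> = 0"
    and noise_consts: "0 \<le> alpha" "0 \<le> sigma" "0 \<le> kappaS" "0 < gammaS" "gammaS \<le> 4"
    and noise_fourth_moment:
      "\<And>i w. w \<in> borel_measurable (F i) \<Longrightarrow>
         AE \<omega> in M. nn_cond_exp M (F i)
             (\<lambda>\<omega>. ennreal (norm (grad_noise J ghat i \<omega> (w \<omega>)) ^ 4)) \<omega>
           \<le> ennreal (alpha\<^sup>2 * norm (col wo - w \<omega>) ^ 4 + sigma ^ 4)"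
    and noise_cov_smooth:
      "\<And>i w. w \<in> borel_measurable (F i) \<Longrightarrow>
         AE \<omega> in M. mat_norm
             (cond_second_moment M (F i) (\<lambda>\<omega>. grad_noise J ghat i \<omega> (col wo)) \<omega>
              - cond_second_moment M (F i) (\<lambda>\<omega>. grad_noise J ghat i \<omega> (w \<omega>)) \<omega>)
           \<le> kappaS * norm (col wo - w \<omega>) powr gammaS"
    and noise_cov_limit:
      "AE \<omega> in M. (\<lambda>i. cond_second_moment M (F i) (\<lambda>\<omega>. grad_noise J ghat i \<omega> (col wo)) \<omega>)
         \<longlonglongrightarrow> Rs"
    and Rs_pos_def: "pos_def Rs"


section \<open>Group-wise adapt-then-combine diffusion\<close>

text \<open>
  Indices of iterates are shifted like those of the filtration: \<open>iterate \<dots> i\<close> is the estimate before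
  iteration \<open>i\<close>, so \<open>iterate \<dots> 0 = 0\<close> is the initial one, and \<open>iterate \<dots> (Suc i)\<close> results from
  iteration \<open>i\<close>.
\<close>

primrec iterate ::
  "('n::finite \<Rightarrow> 'n set) \<Rightarrow> 'n set set \<Rightarrow> real^'n^'n \<Rightarrow> ('n \<Rightarrow> real)
     \<Rightarrow> ('n \<Rightarrow> nat \<Rightarrow> 'a \<Rightarrow> real^'m::finite \<Rightarrow> real^'m) \<Rightarrow> nat \<Rightarrow> 'a \<Rightarrow> 'n \<Rightarrow> real^'m" where
  "iterate nbhd groups A mu ghat 0 = (\<lambda>\<omega> k. 0)"
| "iterate nbhd groups A mu ghat (Suc i) = (\<lambda>\<omega> k.
     let w = iterate nbhd groups A mu ghat i \<omega>;
         psi = (\<lambda>l. w l - mu l *\<^sub>R ghat l i \<omega> (w l))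
     in \<Sum>l \<in> nbhd k \<inter> group_of groups k. A $ l $ k *\<^sub>R psi l)"

definition net_iterate ::
  "('n::finite \<Rightarrow> 'n set) \<Rightarrow> 'n set set \<Rightarrow> real^'n^'n \<Rightarrow> ('n \<Rightarrow> real)
     \<Rightarrow> ('n \<Rightarrow> nat \<Rightarrow> 'a \<Rightarrow> real^'m::finite \<Rightarrow> real^'m) \<Rightarrow> nat \<Rightarrow> 'a \<Rightarrow> real^('n \<times> 'm)" where
  "net_iterate nbhd groups A mu ghat i \<omega> = col (iterate nbhd groups A mu ghat i \<omega>)"

definition net_error ::
  "('n::finite \<Rightarrow> 'n set) \<Rightarrow> 'n set set \<Rightarrow> real^'n^'n \<Rightarrow> ('n \<Rightarrow> real)
     \<Rightarrow> ('n \<Rightarrow> nat \<Rightarrow> 'a \<Rightarrow> real^'m::finite \<Rightarrow> real^'m) \<Rightarrow> ('n \<Rightarrow> real^'m)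
     \<Rightarrow> nat \<Rightarrow> 'a \<Rightarrow> real^('n \<times> 'm)" where
  "net_error nbhd groups A mu ghat wo i \<omega> = col wo - net_iterate nbhd groups A mu ghat i \<omega>"

definition ext_combination :: "real^'n::finite^'n \<Rightarrow> real^('n \<times> 'm::finite)^('n \<times> 'm)" where
  "ext_combination A = kron A (mat 1)"

definition ext_steps :: "('n::finite \<Rightarrow> real) \<Rightarrow> real^('n \<times> 'm::finite)^('n \<times> 'm)" where
  "ext_steps mu = kron (diag mu) (mat 1)"

text \<open>The argument \<open>e\<close> below is the stacked error vector.\<close>

definition mean_hessian ::
  "('n::finite \<Rightarrow> real^'m::finite \<Rightarrow> real) \<Rightarrow> ('n \<Rightarrow> real^'m) \<Rightarrow> real^('n \<times> 'm)
     \<Rightarrow> real^('n \<times> 'm)^('n \<times> 'm)" where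
  "mean_hessian J wo e =
     block_diag (\<lambda>k. integral {0..1} (\<lambda>t. hessian (J k) (wo k - t *\<^sub>R block k e)))"

definition error_matrix ::
  "real^'n::finite^'n \<Rightarrow> ('n \<Rightarrow> real) \<Rightarrow> ('n \<Rightarrow> real^'m::finite \<Rightarrow> real) \<Rightarrow> ('n \<Rightarrow> real^'m)
     \<Rightarrow> real^('n \<times> 'm) \<Rightarrow> real^('n \<times> 'm)^('n \<times> 'm)" where
  "error_matrix A mu J wo e =
     transpose (ext_combination A) ** (mat 1 - ext_steps mu ** mean_hessian J wo e)"

end

theory Submission
  imports Defs
begin

text \<open>
  Write \<open>e\<close> for the stacked error and \<open>mu\<close> for the largest step-size. One iteration first moves every
  block of \<open>e\<close> against its gradient, then averages the blocks inside each group with the transposed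
  combination matrix, and adds averaged noise of size \<open>mu\<close>. The proof is a Lyapunov argument
  with a weighted Euclidean norm, the \<^emph>\<open>energy\<close> \<open>W e = (\<Sum>k. p k * (norm (e k))\<^sup>2)\<close>, where \<open>p\<close> is a positive
  vector fixed by \<open>A\<close> (lemma \<open>stationary_weights\<close>).

  Averaging does not increase \<open>W\<close>: it lowers it by exactly the weighted variance that each agent sees
  among its neighbours, here called the \<^emph>\<open>spread\<close> (lemma \<open>energy_mix\<close>). The gradient step lowers \<open>W\<close> by a
  multiple of \<open>mu\<close> times the energy at the strongly convex agents, up to terms of order \<open>mu\<^sup>2\<close>. An
  error without spread is constant on each connected group, and every group has a strongly convex
  agent; so the two losses together form a positive definite quadratic form, which
  by compactness dominates a multiple of \<open>W\<close> (lemma \<open>coercive\<close>). Hence the noiseless iteration maps \<open>W\<close>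
  below \<open>(1 - c * mu) * W\<close> for some \<open>c > 0\<close> and small \<open>mu\<close> (lemma \<open>energy_contraction\<close>).

  For the noisy iteration, \<open>W\<^sup>2\<close> is expanded. The term linear in the noise has zero expectation, as the
  noise is conditionally centered; the other mixed terms are absorbed by Young's
  inequality into the contraction, at the price of a factor of order \<open>1 / mu\<close> on the fourth power of
  the noise term (lemma \<open>fourth_moment_step\<close>). That fourth power is of order \<open>mu ^ 4 * (1 + W\<^sup>2)\<close>, so the
  expectation \<open>X\<close> of \<open>W\<^sup>2\<close> satisfies \<open>X' \<le> (1 - c * mu) * X + D * mu ^ 3 * (1 + X)\<close> (lemma
  \<open>mean_fourth_step\<close>), and its limit superior is of order \<open>mu ^ 3 / mu = mu\<^sup>2\<close>. The second
  moment is then of order \<open>mu\<close> by the arithmetic-geometric mean inequality.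

  The error recursion itself is the fundamental theorem of calculus for the gradients, combined with the
  fact that all agents of a group share their minimizer (lemma \<open>net_error_recursion\<close>).
\<close>

section \<open>Block calculus\<close>

lemma block_nth [simp]: "block k x $ j = x $ (k, j)"
  by (simp add: block_def)

lemma block_eqI: "(\<And>k. block k x = block k y) \<Longrightarrow> x = y"
  by (metis block_nth surj_pair vec_eq_iff)

lemma block_col [simp]: "block k (col v) = v k"
  by (simp add: block_def col_def)

lemma linear_block: "linear (block k)"
  by (rule linearI) (auto simp: vec_eq_iff)

lemma bounded_linear_block: "bounded_linear (block k)"
  using linear_block linear_conv_bounded_linear by blast

lemma block_add [simp]: "block k (x + y) = block k x + block k y"
  and block_diff [simp]: "block k (x - y) = block k x - block k y"
  and block_scaleR [simp]: "block k (c *\<^sub>R x) = c *\<^sub>R block k x"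
  and block_zero [simp]: "block k 0 = 0"
  by (auto simp: vec_eq_iff)

lemma inner_blocks:
  fixes x y :: "real^('n::finite \<times> 'm::finite)"
  shows "x \<bullet> y = (\<Sum>k\<in>UNIV. block k x \<bullet> block k y)"
  by (simp add: inner_vec_def sum.cartesian_product case_prod_unfold flip: UNIV_Times_UNIV)

lemma norm_blocks: "(norm x)\<^sup>2 = (\<Sum>k\<in>UNIV. (norm (block k x))\<^sup>2)"
  by (simp add: power2_norm_eq_inner inner_blocks)

lemma norm_block_le: "norm (block k x) \<le> norm x"
proof -
  have "(norm (block k x))\<^sup>2 \<le> (norm x)\<^sup>2"
    unfolding norm_blocks by (rule member_le_sum) auto
  then show ?thesis by (simp add: power2_le_iff_abs_le)
qed

lemma block_transpose_ext_combination:
  "block k (transpose (ext_combination A) *v x) = (\<Sum>l\<in>UNIV. A $ l $ k *\<^sub>R block l x)"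
proof (rule vec_eq_iff[THEN iffD2, rule_format])
  fix j
  have "block k (transpose (ext_combination A) *v x) $ j
      = (\<Sum>l\<in>UNIV. \<Sum>j'\<in>UNIV. A $ l $ k * (if j' = j then 1 else 0) * x $ (l, j'))"
    by (simp add: matrix_vector_mult_def transpose_def ext_combination_def kron_def mat_def
        sum.cartesian_product case_prod_unfold flip: UNIV_Times_UNIV)
  also have "\<dots> = (\<Sum>l\<in>UNIV. A $ l $ k * x $ (l, j))"
    by (simp add: if_distrib if_distribR sum.delta cong: if_cong)
  finally show "block k (transpose (ext_combination A) *v x) $ j
      = (\<Sum>l\<in>UNIV. A $ l $ k *\<^sub>R block l x) $ j"
    by simp
qed

lemma block_block_diag: "block k (block_diag D *v x) = D k *v block k x"
proof (rule vec_eq_iff[THEN iffD2, rule_format])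
  fix j
  have "block k (block_diag D *v x) $ j
      = (\<Sum>l\<in>UNIV. \<Sum>j'\<in>UNIV. (if k = l then D k $ j $ j' else 0) * x $ (l, j'))"
    by (simp add: matrix_vector_mult_def block_diag_def
        sum.cartesian_product case_prod_unfold cong: if_cong flip: UNIV_Times_UNIV)
  also have "\<dots> = (\<Sum>l\<in>UNIV. if k = l then \<Sum>j'\<in>UNIV. D k $ j $ j' * x $ (l, j') else 0)"
    by (rule sum.cong) auto
  finally show "block k (block_diag D *v x) $ j = (D k *v block k x) $ j"
    by (simp add: matrix_vector_mult_def)
qed

lemma ext_steps_eq_block_diag: "ext_steps mu = block_diag (\<lambda>k. mat (mu k))"
  by (auto simp: ext_steps_def kron_def block_diag_def mat_def diag_def vec_eq_iff)

lemma mat_scalar_mult: "mat c *v (v :: real^'m::finite) = c *\<^sub>R v"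
  by (simp add: vec_eq_iff matrix_vector_mult_def mat_def if_distrib if_distribR sum.delta
      cong: if_cong)

lemma block_ext_steps: "block k (ext_steps mu *v x) = mu k *\<^sub>R block k x"
  by (simp add: ext_steps_eq_block_diag block_block_diag mat_scalar_mult)

section \<open>Gradients and averaged Hessians\<close>

lemma gradient_derivative:
  fixes f :: "real^'m::finite \<Rightarrow> real"
  assumes "twice_differentiable f"
  shows "(f has_derivative (\<lambda>h. h \<bullet> gradient f x)) (at x)"
proof -
  obtain f' where f': "(f has_derivative f') (at x)"
    using assms unfolding twice_differentiable_def differentiable_on_def differentiable_def
    by auto
  have *: "f' h = h \<bullet> adjoint f' 1" for h
    using adjoint_works[OF has_derivative_linear[OF f'], of h 1] by simp
  have "GDERIV f x :> adjoint f' 1"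
    using f' unfolding gderiv_def by (subst *[symmetric]) (simp add: eta_contract_eq)
  moreover have "g = adjoint f' 1" if "GDERIV f x :> g" for g
  proof -
    have "f' = (\<lambda>h. h \<bullet> g)"
      using has_derivative_unique[OF f'] that unfolding gderiv_def by blast
    then have "h \<bullet> g = h \<bullet> adjoint f' 1" for h using * by metis
    then show ?thesis by (metis vector_eq_rdot inner_commute)
  qed
  ultimately have "GDERIV f x :> gradient f x"
    unfolding gradient_def by (rule theI)
  then show ?thesis unfolding gderiv_def .
qed

lemma gradient_has_derivative:
  assumes "twice_differentiable f"
  shows "(gradient f has_derivative (\<lambda>h. hessian f x *v h)) (at x)"
  using assms unfolding twice_differentiable_def hessian_def differentiable_on_def
  by (simp add: jacobian_works)

lemma continuous_gradient:
  assumes "twice_differentiable f"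
  shows "continuous_on S (gradient f)"
  using gradient_has_derivative[OF assms] has_derivative_continuous
  by (blast intro: continuous_at_imp_continuous_on)

lemma gradient_at_minimizer:
  fixes f :: "real^'m::finite \<Rightarrow> real"
  assumes "twice_differentiable f" "unique_minimizer f x"
  shows "gradient f x = 0"
proof -
  have "is_arg_min f (\<lambda>_. True) x"
    using assms(2) unfolding unique_minimizer_def by simp
  then have "\<forall>y\<in>UNIV. f x \<le> f y"
    unfolding is_arg_min_def by (metis not_le)
  then have "(\<lambda>h. h \<bullet> gradient f x) = (\<lambda>v. 0)"
    using differential_zero_maxmin[OF _ open_UNIV gradient_derivative[OF assms(1)]] by blast
  then have "gradient f x \<bullet> gradient f x = 0"
    by metis
  then show ?thesis by simp
qed

text \<open>
  A Cauchy-Schwarz argument for the form \<open>v \<bullet> (X *v v)\<close>, which replaces the spectral theorem: the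
  form is evaluated at \<open>U *\<^sub>R v - X *v v\<close>, where the cross term is \<open>- 2 * U * (norm (X *v v))\<^sup>2\<close>.
\<close>

lemma pos_semidef_norm_le:
  fixes X :: "real^'m::finite^'m"
  assumes psd: "pos_semidef X" and upper: "pos_semidef (mat U - X)"
  shows "norm (X *v v) \<le> U * norm v"
proof -
  have sym: "x \<bullet> (X *v y) = (X *v x) \<bullet> y" for x y
    using psd unfolding pos_semidef_def by (metis dot_lmul_matrix inner_commute
        matrix_transpose_mul transpose_matrix_vector vector_transpose_matrix)
  have nonneg: "0 \<le> x \<bullet> (X *v x)" for x
    using psd unfolding pos_semidef_def by blast
  have le: "x \<bullet> (X *v x) \<le> U * (norm x)\<^sup>2" for x
  proof -
    have "0 \<le> x \<bullet> ((mat U - X) *v x)"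
      using upper unfolding pos_semidef_def by blast
    then show ?thesis
      by (simp add: matrix_vector_mult_diff_rdistrib mat_scalar_mult inner_diff_right
          power2_norm_eq_inner)
  qed
  let ?w = "X *v v"
  show ?thesis
  proof (cases "?w = 0")
    case True
    have "0 \<le> U * (norm v)\<^sup>2" using le[of v] nonneg[of v] by linarith
    then have "0 \<le> U * norm v"
      by (cases "v = 0") (auto simp: zero_le_mult_iff)
    then show ?thesis using True by simp
  next
    case False
    define n where "n = (norm ?w)\<^sup>2"
    have n: "n > 0" using False by (simp add: n_def)
    have n_inner: "?w \<bullet> ?w = n" by (simp add: n_def power2_norm_eq_inner)
    have U: "0 \<le> U"
      using le[of ?w] nonneg[of ?w] n unfolding n_def by (meson order_trans zero_le_mult_iff not_le)
    have "0 \<le> (U *\<^sub>R v - ?w) \<bullet> (X *v (U *\<^sub>R v - ?w))" by (rule nonneg)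
    also have "\<dots> = U\<^sup>2 * (v \<bullet> ?w) - 2 * U * n + ?w \<bullet> (X *v ?w)"
      using sym[of v ?w] n_inner
      by (simp add: power2_eq_square inner_commute algebra_simps)
    also have "\<dots> \<le> U\<^sup>2 * (U * (norm v)\<^sup>2) - 2 * U * n + U * n"
      using le[of v] le[of ?w] U unfolding n_def by (intro add_mono diff_mono mult_left_mono) auto
    finally have *: "U * n \<le> U * (U * norm v)\<^sup>2"
      by (simp add: power2_eq_square algebra_simps)
    have "U > 0"
    proof (rule ccontr)
      assume "\<not> U > 0"
      then have "U = 0" using U by simp
      \<comment> \<open>then the form vanishes identically, hence so does its polar form\<close>
      then have z: "x \<bullet> (X *v x) = 0" for x using le[of x] nonneg[of x] by simp
      have "0 = (v + ?w) \<bullet> (X *v (v + ?w))" by (simp add: z)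
      also have "\<dots> = 2 * n"
        using sym[of v ?w] z[of v] z[of ?w]
        by (simp add: matrix_vector_right_distrib inner_add_left
            inner_add_right inner_commute n_def power2_norm_eq_inner)
      finally show False using n by simp
    qed
    then have "(norm ?w)\<^sup>2 \<le> (U * norm v)\<^sup>2" using * by (simp add: n_def)
    then show ?thesis using U by (simp add: power2_le_iff_abs_le)
  qed
qed

lemma continuous_on_matrix:
  fixes H :: "'a::metric_space \<Rightarrow> real^'m::finite^'n::finite"
  assumes "0 \<le> K" and "\<And>u v i j. \<bar>H u $ i $ j - H v $ i $ j\<bar> \<le> K * dist u v"
  shows "continuous_on S H"
proof -
  have "K-lipschitz_on S (\<lambda>u. H u $ i $ j)" for i j
    using assms by (intro lipschitz_onI) (auto simp: dist_real_def)
  then have *: "continuous_on S (\<lambda>u. H u $ i $ j)" for i j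
    by (rule lipschitz_on_continuous_on)
  have "continuous_on S (\<lambda>u. \<chi> i j. H u $ i $ j)"
    by (intro continuous_intros *)
  then show ?thesis by simp
qed

text \<open>
  The fundamental theorem of calculus along the segment from \<open>x\<close> to \<open>x - e\<close>. It turns the averaged
  Hessian of the error recursion into a gradient difference. Continuity of the Hessian is
  what makes the averaged matrix itself, and not only its product with \<open>e\<close>, a well-defined integral.
\<close>

lemma averaged_hessian:
  fixes f :: "real^'m::finite \<Rightarrow> real"
  assumes f: "twice_differentiable f"
    and cont: "continuous_on UNIV (hessian f)"
  shows "((\<lambda>t. hessian f (x - t *\<^sub>R e) *v e) has_integral
            gradient f x - gradient f (x - e)) {0..1}"
    and "integral {0..1} (\<lambda>t. hessian f (x - t *\<^sub>R e)) *v e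
           = gradient f x - gradient f (x - e)"
proof -
  have d: "((\<lambda>t. - gradient f (x - t *\<^sub>R e)) has_vector_derivative
          hessian f (x - t *\<^sub>R e) *v e) (at t within {0..1})" for t
  proof -
    have "((\<lambda>t. gradient f (x - t *\<^sub>R e)) has_derivative
          (\<lambda>h. hessian f (x - t *\<^sub>R e) *v (- (h *\<^sub>R e)))) (at t within {0..1})"
      by (rule has_derivative_compose[OF _ gradient_has_derivative[OF f]])
        (auto intro!: derivative_eq_intros)
    from has_derivative_minus[OF this] show ?thesis
      by (simp add: has_vector_derivative_def matrix_vector_mult_scaleR
          linear_neg[OF matrix_vector_mul_linear] del: scaleR_minus_left)
  qed
  show *: "((\<lambda>t. hessian f (x - t *\<^sub>R e) *v e) has_integral
            gradient f x - gradient f (x - e)) {0..1}"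
    using fundamental_theorem_of_calculus[OF zero_le_one d] by simp
  have "continuous_on {0..1} (\<lambda>t. hessian f (x - t *\<^sub>R e))"
    by (rule continuous_on_compose2[OF cont]) (auto intro!: continuous_intros)
  then have "((\<lambda>t. hessian f (x - t *\<^sub>R e)) has_integral
      integral {0..1} (\<lambda>t. hessian f (x - t *\<^sub>R e))) {0..1}"
    by (intro integrable_integral integrable_continuous_real)
  then have "((\<lambda>t. hessian f (x - t *\<^sub>R e) *v e) has_integral
      integral {0..1} (\<lambda>t. hessian f (x - t *\<^sub>R e)) *v e) {0..1}"
    by (rule has_integral_linear[unfolded o_def])
      (simp add: linear_conv_bounded_linear[symmetric] linear_iff matrix_vector_mult_add_rdistrib
        scaleR_matrix_vector_assoc)
  with * show "integral {0..1} (\<lambda>t. hessian f (x - t *\<^sub>R e)) *v e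
           = gradient f x - gradient f (x - e)"
    by (rule has_integral_unique[symmetric])
qed

text \<open>
  The curvature bounds, integrated along a segment. With \<open>x\<close> a minimizer, they say that the gradient
  pulls back towards \<open>x\<close> with strength \<open>a\<close> and grows at most linearly with slope \<open>b\<close>.
\<close>

lemma gradient_monotone_and_lipschitz:
  fixes f :: "real^'m::finite \<Rightarrow> real"
  assumes f: "twice_differentiable f"
    and cont: "continuous_on UNIV (hessian f)"
    and lower: "\<And>w. loewner_le (mat a) (hessian f w)"
    and upper: "\<And>w. loewner_le (hessian f w) (mat b)"
    and "0 \<le> a" "a \<le> b"
  shows "a * (norm e)\<^sup>2 \<le> e \<bullet> (gradient f x - gradient f (x - e))"
    and "norm (gradient f x - gradient f (x - e)) \<le> b * norm e"
proof -
  note I = averaged_hessian(1)[OF f cont, of x e]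
  have low: "a * (norm v)\<^sup>2 \<le> v \<bullet> (hessian f w *v v)" for v w
    using lower[of w] unfolding loewner_le_def pos_semidef_def
    by (auto simp: matrix_vector_mult_diff_rdistrib mat_scalar_mult inner_diff_right
        power2_norm_eq_inner)
  have sym: "transpose (hessian f w) = hessian f w" for w
  proof -
    have "transpose (hessian f w - mat a) = hessian f w - mat a"
      using lower[of w] unfolding loewner_le_def pos_semidef_def by blast
    then have *: "(transpose (hessian f w - mat a)) $ i $ j = (hessian f w - mat a) $ i $ j" for i j
      by simp
    have "hessian f w $ j $ i = hessian f w $ i $ j" for i j
      using *[of i j] by (cases "i = j") (simp_all add: transpose_def mat_def)
    then show ?thesis by (simp add: transpose_def vec_eq_iff)
  qed
  have psd: "pos_semidef (hessian f w)" for w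
    unfolding pos_semidef_def
  proof (intro conjI allI sym)
    fix v :: "real^'m"
    have "0 \<le> a * (norm v)\<^sup>2" using \<open>0 \<le> a\<close> by simp
    then show "0 \<le> v \<bullet> (hessian f w *v v)" using low[of v w] by linarith
  qed
  have up: "((\<lambda>t. e \<bullet> (hessian f (x - t *\<^sub>R e) *v e)) has_integral
          e \<bullet> (gradient f x - gradient f (x - e))) {0..1}"
    using has_integral_linear[OF I bounded_linear_inner_right] by (simp add: o_def)
  have "((\<lambda>t. a * (norm e)\<^sup>2) has_integral a * (norm e)\<^sup>2) {0..1::real}"
    using has_integral_const_real[of "a * (norm e)\<^sup>2" 0 1] by simp
  from has_integral_le[OF this up low]
  show "a * (norm e)\<^sup>2 \<le> e \<bullet> (gradient f x - gradient f (x - e))" .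
  have "norm (hessian f w *v e) \<le> b * norm e" for w
    using pos_semidef_norm_le[OF psd] upper unfolding loewner_le_def by blast
  then show "norm (gradient f x - gradient f (x - e)) \<le> b * norm e"
    using has_integral_bound_real[of "b * norm e" "{}", OF _ finite.emptyI I] \<open>0 \<le> a\<close> \<open>a \<le> b\<close>
    by (simp add: order_trans[OF \<open>0 \<le> a\<close>])
qed

section \<open>Positive stationary weights\<close>

lemma group_of_unique:
  assumes "partition_on UNIV groups" "g \<in> groups" "k \<in> g"
  shows "group_of groups k = g"
  unfolding group_of_def
  using assms partition_onD2[OF assms(1)] by (intro the_equality) (auto simp: disjoint_def)

lemma group_of_mem:
  assumes "partition_on UNIV groups"
  shows "group_of groups k \<in> groups" "k \<in> group_of groups k"
proof -
  obtain g where "g \<in> groups" "k \<in> g"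
    using partition_onD1[OF assms] by blast
  then show "group_of groups k \<in> groups" "k \<in> group_of groups k"
    using group_of_unique[OF assms] by auto
qed

locale grouped_network =
  clustered_network nbhd clusters groups + combination_matrix nbhd groups A
  for nbhd :: "'n::{finite,linorder} \<Rightarrow> 'n set"
    and clusters groups :: "'n set set"
    and A :: "((real, 'n) vec, 'n) vec"
begin

lemma weight_nonneg: "0 \<le> A $ l $ k"
  using weight_pos[of l k] weight_zero[of l k] by (cases "l \<in> nbhd k \<inter> group_of groups k") auto

lemma weight_outside_group: "k \<in> g \<Longrightarrow> g \<in> groups \<Longrightarrow> l \<notin> g \<Longrightarrow> A $ l $ k = 0"
  using weight_zero[of l k] group_of_unique[OF groups] by auto

lemma weight_link: "k \<in> g \<Longrightarrow> g \<in> groups \<Longrightarrow> l \<in> g \<Longrightarrow> l \<in> nbhd k \<Longrightarrow> 0 < A $ l $ k"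
  using weight_pos[of l k] group_of_unique[OF groups] by auto

text \<open>
  Mass cannot leave a group, since columns sum to one and weights across groups vanish.
\<close>

lemma sum_over_group:
  assumes g: "g \<in> groups"
  shows "(\<Sum>k\<in>g. (A *v p) $ k) = (\<Sum>k\<in>g. p $ k)"
proof -
  have "A $ k $ l * p $ l = 0" if "k \<in> g" "l \<notin> g" for k l
  proof -
    have "k \<notin> group_of groups l"
    proof
      assume "k \<in> group_of groups l"
      then have "group_of groups l = g"
        using group_of_unique[OF groups] group_of_mem(1)[OF groups] g that(1) by metis
      then show False using group_of_mem(2)[OF groups, of l] that(2) by simp
    qed
    then show ?thesis using weight_zero[of k l] by simp
  qed
  then have "(\<Sum>l\<in>UNIV. A $ k $ l * p $ l) = (\<Sum>l\<in>g. A $ k $ l * p $ l)" if "k \<in> g" for k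
    using that by (intro sum.mono_neutral_right) auto
  then have "(\<Sum>k\<in>g. (A *v p) $ k) = (\<Sum>k\<in>g. \<Sum>l\<in>g. A $ k $ l * p $ l)"
    by (simp add: matrix_vector_mult_def)
  also have "\<dots> = (\<Sum>l\<in>g. (\<Sum>k\<in>g. A $ k $ l) * p $ l)"
    by (subst sum.swap) (simp add: sum_distrib_right)
  also have "\<dots> = (\<Sum>l\<in>g. (\<Sum>k\<in>UNIV. A $ k $ l) * p $ l)"
    using g weight_outside_group
    by (intro sum.cong refl arg_cong2[where f="(*)"] sum.mono_neutral_left) auto
  finally show ?thesis by (simp add: left_stochastic)
qed

text \<open>
  Some agent of the group carries mass, and positivity spreads from \<open>b\<close> to \<open>a\<close> along every link from
  \<open>a\<close> to \<open>b\<close>, because \<open>A\<close> then puts positive weight on the entry \<open>(a, b)\<close>.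
\<close>

lemma stationary_positive:
  assumes nonneg: "\<And>k. 0 \<le> p $ k" and mass: "\<And>g. g \<in> groups \<Longrightarrow> (\<Sum>k\<in>g. p $ k) = 1"
    and fixed: "A *v p = p"
  shows "0 < p $ k"
proof -
  define g where "g = group_of groups k"
  have g: "g \<in> groups" "k \<in> g" unfolding g_def using group_of_mem[OF groups] by auto
  obtain l where l: "l \<in> g" "0 < p $ l"
  proof (rule ccontr)
    assume "\<not> thesis"
    then have "\<forall>l\<in>g. p $ l = 0" using that nonneg by (metis order_le_less)
    then show False using mass[OF g(1)] by simp
  qed
  have "(k, l) \<in> {(a, b). a \<in> g \<and> b \<in> g \<and> a \<in> nbhd b}\<^sup>*"
    using group_connected g l by blast
  then show ?thesis
  proof (induction rule: converse_rtrancl_induct)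
    case base then show ?case by (rule l(2))
  next
    case (step a b)
    have "0 < A $ a $ b * p $ b"
      using step g weight_link[of b g a] by auto
    also have "\<dots> \<le> (\<Sum>b\<in>UNIV. A $ a $ b * p $ b)"
      by (rule member_le_sum) (auto simp: weight_nonneg nonneg)
    also have "\<dots> = p $ a"
      using fixed by (simp add: matrix_vector_mult_def vec_eq_iff)
    finally show ?case .
  qed
qed

text \<open>
  The Perron vectors of all groups at once, by Brouwer's theorem: \<open>A\<close> maps the product of the
  probability simplices of the groups into itself.
\<close>

lemma stationary_weights:
  obtains p where "\<And>k. 0 < p $ k" "A *v p = p"
proof -
  define S where "S = {p :: (real,'n) vec. (\<forall>k. 0 \<le> p $ k) \<and> (\<forall>g\<in>groups. (\<Sum>k\<in>g. p $ k) = 1)}"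
  have S: "S = (\<Inter>k. {p. 0 \<le> p $ k}) \<inter> (\<Inter>g\<in>groups. {p. (\<Sum>k\<in>g. p $ k) = 1})"
    unfolding S_def by auto
  have le1: "p $ k \<le> 1" if "p \<in> S" for p k
  proof -
    have "p $ k \<le> (\<Sum>k\<in>group_of groups k. p $ k)"
      using that group_of_mem[OF groups] unfolding S_def by (intro member_le_sum) auto
    then show ?thesis using that group_of_mem(1)[OF groups] unfolding S_def by auto
  qed
  have "closed S"
    unfolding S
    by (intro closed_Int closed_INT ballI closed_Collect_le closed_Collect_eq continuous_intros)
  moreover have "bounded S"
    using le1 unfolding S_def
    by (intro bounded_subset[OF bounded_cbox[of 0 "\<chi> k. 1"]]) (auto simp: mem_box_cart)
  ultimately have "compact S" by (simp add: compact_eq_bounded_closed)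
  moreover have "convex S"
    unfolding S_def
    by (intro convexI) (auto simp: sum.distrib sum_distrib_left[symmetric])
  moreover have "S \<noteq> {}"
  proof -
    have "(\<chi> k. 1 / card (group_of groups k)) \<in> S"
    proof -
      have "(\<Sum>k\<in>g. 1 / real (card (group_of groups k))) = 1" if "g \<in> groups" for g
      proof -
        have "(\<Sum>k\<in>g. 1 / real (card (group_of groups k))) = (\<Sum>k\<in>g. 1 / real (card g))"
          using group_of_unique[OF groups that] by (intro sum.cong) auto
        then show ?thesis
          using that partition_onD3[OF groups] by auto
      qed
      then show ?thesis unfolding S_def by simp
    qed
    then show ?thesis by blast
  qed
  moreover have "continuous_on S ((*v) A)"
    by (simp add: linear_continuous_on)
  moreover have "(*v) A \<in> S \<rightarrow> S"
    unfolding S_def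
    by (auto simp: sum_over_group) (auto simp: matrix_vector_mult_def weight_nonneg intro!: sum_nonneg)
  ultimately obtain p where "p \<in> S" "A *v p = p"
    using brouwer by metis
  then show ?thesis
    using stationary_positive unfolding S_def by (intro that) auto
qed

end

section \<open>Contraction of the weighted energy\<close>

definition mix ::
  "real^'n::finite^'n \<Rightarrow> real^('n \<times> 'm::finite) \<Rightarrow> real^('n \<times> 'm)" where
  "mix A x = transpose (ext_combination A) *v x"

definition energy :: "real^'n::finite \<Rightarrow> real^('n \<times> 'm::finite) \<Rightarrow> real" where
  "energy p x = (\<Sum>k\<in>UNIV. p $ k * (norm (block k x))\<^sup>2)"

text \<open>
  The \<open>p\<close>-weighted sum of the local variances: agent \<open>k\<close> draws a neighbour \<open>l\<close> with probability
  \<open>A $ l $ k\<close>, and the inner sum is the variance of the block of \<open>l\<close>.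
\<close>

definition spread ::
  "real^'n::finite^'n \<Rightarrow> real^'n \<Rightarrow> real^('n \<times> 'm::finite) \<Rightarrow> real" where
  "spread A p x = (\<Sum>k\<in>UNIV. p $ k * (\<Sum>l\<in>UNIV. A $ l $ k *
     (norm (block l x - block k (mix A x)))\<^sup>2))"

lemma block_mix: "block k (mix A x) = (\<Sum>l\<in>UNIV. A $ l $ k *\<^sub>R block l x)"
  unfolding mix_def by (rule block_transpose_ext_combination)

lemma mix_diff: "mix A (x - y) = mix A x - mix A y"
  and mix_scaleR: "mix A (c *\<^sub>R x) = c *\<^sub>R mix A x"
  by (simp_all add: mix_def matrix_vector_mult_diff_distrib matrix_vector_mult_scaleR)

text \<open>
  Compactness of the unit sphere. It yields the contraction rate below without computing a spectral
  gap of \<open>A\<close>.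
\<close>

lemma homogeneous_pos_lower_bound:
  fixes Q :: "'a::euclidean_space \<Rightarrow> real"
  assumes cont: "continuous_on UNIV Q"
    and hom: "\<And>c x. Q (c *\<^sub>R x) = c\<^sup>2 * Q x"
    and pos: "\<And>x. x \<noteq> 0 \<Longrightarrow> 0 < Q x"
  obtains c where "0 < c" "\<And>x. c * (norm x)\<^sup>2 \<le> Q x"
proof -
  have ne: "sphere (0::'a) 1 \<noteq> {}" by simp
  obtain u where u: "u \<in> sphere 0 1" "\<And>x. x \<in> sphere 0 1 \<Longrightarrow> Q u \<le> Q x"
    using continuous_attains_inf[OF compact_sphere ne continuous_on_subset[OF cont subset_UNIV]]
    by blast
  have "Q u * (norm x)\<^sup>2 \<le> Q x" for x
  proof (cases "x = 0")
    case True
    then show ?thesis using hom[of 0 x] by simp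
  next
    case False
    have "Q u \<le> Q (x /\<^sub>R norm x)" using False by (intro u(2)) simp
    then have "(norm x)\<^sup>2 * Q u \<le> (norm x)\<^sup>2 * Q (x /\<^sub>R norm x)" by (intro mult_left_mono) auto
    also have "\<dots> = Q x" using False by (simp add: hom[symmetric])
    finally show ?thesis by (simp add: mult.commute)
  qed
  moreover have "0 < Q u" using u(1) by (intro pos) auto
  ultimately show ?thesis using that by blast
qed

locale stationary_network = grouped_network nbhd clusters groups A
  for nbhd :: "'n::{finite,linorder} \<Rightarrow> 'n set"
    and clusters groups :: "'n set set"
    and A :: "((real, 'n) vec, 'n) vec" +
  fixes p :: "(real, 'n) vec"
  assumes p_pos: "\<And>k. 0 < p $ k" and p_stationary: "A *v p = p"
begin

lemma p_nonneg: "0 \<le> p $ k"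
  using p_pos[of k] by simp

lemma energy_nonneg: "0 \<le> energy p x"
  unfolding energy_def by (intro sum_nonneg mult_nonneg_nonneg) (auto simp: p_nonneg)

lemma spread_nonneg: "0 \<le> spread A p x"
  unfolding spread_def
  by (intro sum_nonneg mult_nonneg_nonneg) (auto simp: p_nonneg weight_nonneg)

lemma energy_le_norm: "energy p x \<le> (\<Sum>k\<in>UNIV. p $ k) * (norm x)\<^sup>2"
  unfolding energy_def sum_distrib_right
  by (intro sum_mono mult_left_mono power_mono norm_block_le) (auto simp: p_nonneg)

text \<open>
  Second moment equals squared mean plus variance, at every agent; stationarity of \<open>p\<close> turns the
  averaged second moments back into the energy of \<open>x\<close>.
\<close>

lemma energy_mix: "energy p (mix A x) = energy p x - spread A p x"
proof -
  have var: "(\<Sum>l\<in>UNIV. A $ l $ k * (norm (block l x - block k (mix A x)))\<^sup>2)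
      = (\<Sum>l\<in>UNIV. A $ l $ k * (norm (block l x))\<^sup>2) - (norm (block k (mix A x)))\<^sup>2" for k
  proof -
    let ?m = "block k (mix A x)"
    have "(\<Sum>l\<in>UNIV. A $ l $ k * (norm (block l x - ?m))\<^sup>2)
        = (\<Sum>l\<in>UNIV. A $ l $ k * (norm (block l x))\<^sup>2 + A $ l $ k * (norm ?m)\<^sup>2
             - 2 * ((A $ l $ k *\<^sub>R block l x) \<bullet> ?m))"
      by (intro sum.cong refl)
        (simp add: power2_norm_eq_inner inner_diff_left inner_diff_right inner_commute algebra_simps)
    also have "\<dots> = (\<Sum>l\<in>UNIV. A $ l $ k * (norm (block l x))\<^sup>2)
        + (\<Sum>l\<in>UNIV. A $ l $ k) * (norm ?m)\<^sup>2
        - 2 * ((\<Sum>l\<in>UNIV. A $ l $ k *\<^sub>R block l x) \<bullet> ?m)"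
      by (simp only: sum_subtractf sum.distrib sum_distrib_left sum_distrib_right inner_sum_left)
    also have "\<dots> = (\<Sum>l\<in>UNIV. A $ l $ k * (norm (block l x))\<^sup>2) - (norm ?m)\<^sup>2"
      unfolding block_mix[symmetric] left_stochastic by (simp add: power2_norm_eq_inner)
    finally show ?thesis .
  qed
  have "(\<Sum>k\<in>UNIV. p $ k * (\<Sum>l\<in>UNIV. A $ l $ k * (norm (block l x))\<^sup>2))
      = (\<Sum>l\<in>UNIV. (\<Sum>k\<in>UNIV. A $ l $ k * p $ k) * (norm (block l x))\<^sup>2)"
    by (simp add: sum_distrib_left sum_distrib_right mult_ac) (rule sum.swap)
  also have "\<dots> = (\<Sum>l\<in>UNIV. (A *v p) $ l * (norm (block l x))\<^sup>2)"
    by (simp add: matrix_vector_mult_def)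
  also have "\<dots> = energy p x"
    by (simp add: p_stationary energy_def)
  finally show ?thesis
    unfolding spread_def var by (simp add: energy_def right_diff_distrib sum_subtractf)
qed

lemma spread_le_energy: "spread A p x \<le> energy p x"
  using energy_mix[of x] energy_nonneg[of "mix A x"] by linarith

text \<open>
  The spread is a positive semidefinite quadratic form, so it cannot change much under the small
  perturbation of \<open>x\<close> by a gradient step.
\<close>

lemma spread_triangle: "spread A p x \<le> 2 * spread A p (x - z) + 2 * spread A p z"
proof -
  have sq: "(norm (a + b))\<^sup>2 \<le> 2 * (norm a)\<^sup>2 + 2 * (norm b)\<^sup>2" for a b :: "'z::real_inner"
    using zero_le_power2[of "norm (a - b)"]
    by (simp add: power2_norm_eq_inner algebra_simps inner_commute)
  have "spread A p x \<le> (\<Sum>k\<in>UNIV. p $ k * (\<Sum>l\<in>UNIV. A $ l $ k *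
      (2 * (norm (block l (x - z) - block k (mix A (x - z))))\<^sup>2
       + 2 * (norm (block l z - block k (mix A z)))\<^sup>2)))"
    unfolding spread_def
  proof (intro sum_mono mult_left_mono p_nonneg weight_nonneg)
    fix k l
    show "(norm (block l x - block k (mix A x)))\<^sup>2
        \<le> 2 * (norm (block l (x - z) - block k (mix A (x - z))))\<^sup>2
          + 2 * (norm (block l z - block k (mix A z)))\<^sup>2"
      using sq[of "block l (x - z) - block k (mix A (x - z))" "block l z - block k (mix A z)"]
      by (simp add: mix_diff)
  qed
  also have "\<dots> = 2 * spread A p (x - z) + 2 * spread A p z"
    by (simp add: spread_def sum.distrib sum_distrib_left distrib_left mult_ac)
  finally show ?thesis .
qed

text \<open>
  Zero variance at \<open>k\<close> forces all neighbours of \<open>k\<close> in its group, and \<open>k\<close> itself, to share the mean; connectivity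
  of the group propagates the equality. The self-loops take the role of aperiodicity here.
\<close>

lemma spread_zero_constant:
  assumes zero: "spread A p x = 0" and g: "g \<in> groups" "k \<in> g" "l \<in> g"
  shows "block k x = block l x"
proof -
  have agree: "block a x = block k (mix A x)" if "0 < A $ a $ k" for a k
  proof -
    have "p $ k * (\<Sum>l\<in>UNIV. A $ l $ k * (norm (block l x - block k (mix A x)))\<^sup>2) = 0"
      using zero unfolding spread_def
      by (subst (asm) sum_nonneg_eq_0_iff)
        (auto intro!: sum_nonneg mult_nonneg_nonneg simp: p_nonneg weight_nonneg)
    then have "(\<Sum>l\<in>UNIV. A $ l $ k * (norm (block l x - block k (mix A x)))\<^sup>2) = 0"
      using p_pos[of k] by simp
    then have "A $ a $ k * (norm (block a x - block k (mix A x)))\<^sup>2 = 0"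
      by (subst (asm) sum_nonneg_eq_0_iff) (auto simp: weight_nonneg)
    then show ?thesis using that by simp
  qed
  have "(k, l) \<in> {(a, b). a \<in> g \<and> b \<in> g \<and> a \<in> nbhd b}\<^sup>*"
    using group_connected g by blast
  then show ?thesis
  proof (induction rule: converse_rtrancl_induct)
    case base then show ?case by simp
  next
    case (step a b)
    \<comment> \<open>agent \<open>b\<close> hears both \<open>a\<close> and itself\<close>
    have "block a x = block b (mix A x)" "block b x = block b (mix A x)"
      using step(1) g(1) weight_link nbhd_self by (auto intro!: agree)
    then show ?case using step by simp
  qed
qed

lemma continuous_spread: "continuous_on S (spread A p)"
  unfolding spread_def mix_def
  by (intro continuous_intros bounded_linear.continuous_on[OF bounded_linear_block]
      linear_continuous_on matrix_vector_mul_bounded_linear)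

text \<open>
  A vector with vanishing right-hand side has no spread, hence is constant on groups, and vanishes at
  one agent of each group. This is where one strongly convex cost per group is enough.
\<close>

lemma coercive:
  assumes d: "\<And>k. 0 \<le> d k" and strong: "\<And>g. g \<in> groups \<Longrightarrow> \<exists>k\<in>g. 0 < d k"
  obtains c where "0 < c"
    "\<And>x :: real^('n \<times> 'm::finite).
       c * energy p x \<le> (\<Sum>k\<in>UNIV. p $ k * d k * (norm (block k x))\<^sup>2) + spread A p x / 2"
proof -
  define Q where "Q = (\<lambda>x :: real^('n \<times> 'm).
     (\<Sum>k\<in>UNIV. p $ k * d k * (norm (block k x))\<^sup>2) + spread A p x / 2)"
  have "continuous_on UNIV Q"
    unfolding Q_def
    by (intro continuous_intros continuous_spread bounded_linear.continuous_on[OF bounded_linear_block]) auto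
  moreover have "Q (c *\<^sub>R x) = c\<^sup>2 * Q x" for c x
  proof -
    have "spread A p (c *\<^sub>R x) = c\<^sup>2 * spread A p x"
      unfolding spread_def
      by (simp add: mix_scaleR power_mult_distrib sum_distrib_left mult_ac flip: scaleR_diff_right)
    then show ?thesis
      unfolding Q_def by (simp add: power_mult_distrib sum_distrib_left distrib_left mult_ac)
  qed
  moreover have "0 < Q x" if "x \<noteq> 0" for x
  proof (rule ccontr)
    assume "\<not> 0 < Q x"
    moreover have nn: "0 \<le> p $ k * d k * (norm (block k x))\<^sup>2" for k
      by (simp add: p_nonneg d)
    then have "0 \<le> (\<Sum>k\<in>UNIV. p $ k * d k * (norm (block k x))\<^sup>2)"
      by (intro sum_nonneg) auto
    ultimately have "spread A p x = 0" and s0: "(\<Sum>k\<in>UNIV. p $ k * d k * (norm (block k x))\<^sup>2) = 0"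
      using spread_nonneg[of x] unfolding Q_def by linarith+
    have z: "p $ k * d k * (norm (block k x))\<^sup>2 = 0" for k
      using s0 nn by (simp add: sum_nonneg_eq_0_iff)
    have "block k x = block k 0" for k
    proof -
      obtain l where l: "l \<in> group_of groups k" "0 < d l"
        using strong group_of_mem[OF groups] by blast
      have "block l x = 0" using z[of l] l(2) p_pos[of l] by simp
      moreover have "block k x = block l x"
        using spread_zero_constant[OF \<open>spread A p x = 0\<close>] group_of_mem[OF groups] l(1) by blast
      ultimately show ?thesis by simp
    qed
    then show False using that block_eqI by blast
  qed
  ultimately obtain c where c: "0 < c" "\<And>x. c * (norm x)\<^sup>2 \<le> Q x"
    using homogeneous_pos_lower_bound[of Q] by metis
  define P where "P = (\<Sum>k\<in>UNIV. p $ k)"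
  have P: "0 < P" unfolding P_def by (intro sum_pos) (auto simp: p_pos)
  have "c / P * energy p x \<le> Q x" for x
  proof -
    have "c / P * energy p x \<le> c / P * (P * (norm x)\<^sup>2)"
      using energy_le_norm c(1) P unfolding P_def by (intro mult_left_mono) auto
    also have "\<dots> \<le> Q x" using c(2)[of x] P by simp
    finally show ?thesis .
  qed
  then show ?thesis using that[of "c / P"] c(1) P unfolding Q_def by simp
qed

text \<open>
  Mixing removes the spread at a rate independent of \<open>mu\<close>, and the gradient step removes energy at
  rate \<open>mu\<close> at the strongly convex agents. As \<open>mu \<le> 1\<close>, a fraction \<open>mu\<close> of the spread already
  suffices to apply coercivity; all remaining terms are of second order in \<open>mu\<close>.
\<close>

lemma energy_contraction:
  fixes lam tau :: "'n \<Rightarrow> real"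
  assumes tau: "\<And>k. 0 < tau k \<and> tau k \<le> 1"
    and lam: "\<And>k. 0 \<le> lam k" "\<And>g. g \<in> groups \<Longrightarrow> \<exists>k\<in>g. 0 < lam k"
    and L: "0 \<le> L"
  obtains c where "0 < c"
    "\<And>mu (e :: real^('n \<times> 'm::finite)) y. \<lbrakk>0 \<le> mu; mu \<le> 1;
       \<And>k. norm (block k y) \<le> L * norm (block k e);
       \<And>k. lam k * (norm (block k e))\<^sup>2 \<le> block k e \<bullet> block k y\<rbrakk> \<Longrightarrow>
     energy p (mix A (e - ext_steps (\<lambda>k. tau k * mu) *v y))
       \<le> (1 - c * mu + 2 * L\<^sup>2 * mu\<^sup>2) * energy p e"
proof -
  have "\<exists>k\<in>g. 0 < tau k * lam k" if "g \<in> groups" for g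
    using lam(2)[OF that] tau by (metis mult_pos_pos)
  moreover have "0 \<le> tau k * lam k" for k
    using tau[of k] lam(1)[of k] by simp
  ultimately obtain c where c: "0 < c"
    "\<And>x :: real^('n \<times> 'm). c * energy p x
       \<le> (\<Sum>k\<in>UNIV. p $ k * (tau k * lam k) * (norm (block k x))\<^sup>2) + spread A p x / 2"
    using coercive[of "\<lambda>k. tau k * lam k"] by blast
  have "energy p (mix A (e - ext_steps (\<lambda>k. tau k * mu) *v y))
       \<le> (1 - c * mu + 2 * L\<^sup>2 * mu\<^sup>2) * energy p e"
    if mu: "0 \<le> mu" "mu \<le> 1"
      and up: "\<And>k. norm (block k y) \<le> L * norm (block k e)"
      and low: "\<And>k. lam k * (norm (block k e))\<^sup>2 \<le> block k e \<bullet> block k y"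
    for mu and e y :: "real^('n \<times> 'm)"
  proof -
    let ?z = "ext_steps (\<lambda>k. tau k * mu) *v y"
    let ?S = "\<Sum>k\<in>UNIV. p $ k * (tau k * lam k) * (norm (block k e))\<^sup>2"
    have z2: "(norm (block k ?z))\<^sup>2 \<le> L\<^sup>2 * mu\<^sup>2 * (norm (block k e))\<^sup>2" for k
    proof -
      have "norm (block k ?z) = tau k * mu * norm (block k y)"
        using tau[of k] mu by (simp add: block_ext_steps)
      also have "\<dots> \<le> 1 * mu * (L * norm (block k e))"
        using tau[of k] mu up[of k] L by (intro mult_mono) auto
      finally have "(norm (block k ?z))\<^sup>2 \<le> (mu * (L * norm (block k e)))\<^sup>2"
        by (intro power_mono) auto
      then show ?thesis by (simp add: power_mult_distrib mult_ac)
    qed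
    have Ez: "energy p ?z \<le> L\<^sup>2 * mu\<^sup>2 * energy p e"
    proof -
      have "energy p ?z \<le> (\<Sum>k\<in>UNIV. p $ k * (L\<^sup>2 * mu\<^sup>2 * (norm (block k e))\<^sup>2))"
        unfolding energy_def by (intro sum_mono mult_left_mono z2 p_nonneg)
      then show ?thesis by (simp add: energy_def sum_distrib_left mult_ac)
    qed
    have "energy p (e - ?z) = energy p e + energy p ?z
        - 2 * mu * (\<Sum>k\<in>UNIV. p $ k * (tau k * (block k e \<bullet> block k y)))"
    proof -
      have sq: "(norm (v - t *\<^sub>R w))\<^sup>2 = (norm v)\<^sup>2 + (norm (t *\<^sub>R w))\<^sup>2 - 2 * t * (v \<bullet> w)"
        for v w :: "real^'m" and t
        by (simp add: power2_norm_eq_inner inner_diff_left inner_diff_right inner_commute algebra_simps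
            del: norm_scaleR)
      have "p $ k * (norm (block k (e - ?z)))\<^sup>2 = p $ k * (norm (block k e))\<^sup>2
          + p $ k * (norm (block k ?z))\<^sup>2 - 2 * mu * (p $ k * (tau k * (block k e \<bullet> block k y)))" for k
        unfolding block_diff block_ext_steps sq by (simp add: algebra_simps)
      then show ?thesis
        unfolding energy_def by (simp add: sum.distrib sum_subtractf sum_distrib_left)
    qed
    moreover have "?S \<le> (\<Sum>k\<in>UNIV. p $ k * (tau k * (block k e \<bullet> block k y)))"
    proof (intro sum_mono)
      fix k
      have "p $ k * tau k * (lam k * (norm (block k e))\<^sup>2) \<le> p $ k * tau k * (block k e \<bullet> block k y)"
        using p_nonneg[of k] tau[of k] by (intro mult_left_mono low) auto
      then show "p $ k * (tau k * lam k) * (norm (block k e))\<^sup>2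
          \<le> p $ k * (tau k * (block k e \<bullet> block k y))"
        by (simp add: mult_ac)
    qed
    then have "2 * mu * ?S \<le> 2 * mu * (\<Sum>k\<in>UNIV. p $ k * (tau k * (block k e \<bullet> block k y)))"
      using mu by (intro mult_left_mono) auto
    ultimately have Ey: "energy p (e - ?z) \<le> energy p e + energy p ?z - 2 * mu * ?S"
      by linarith
    \<comment> \<open>half of the spread of \<open>e\<close> survives the gradient step, up to a term of order \<open>mu\<^sup>2\<close>\<close>
    have "spread A p e / 2 \<le> spread A p (e - ?z) + energy p ?z"
      using spread_triangle[of e ?z] spread_le_energy[of ?z] by linarith
    then have "energy p (mix A (e - ?z))
        \<le> energy p e + 2 * energy p ?z - 2 * mu * ?S - spread A p e / 2"
      using Ey energy_mix[of "e - ?z"] by linarith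
    also have "\<dots> \<le> energy p e + 2 * (L\<^sup>2 * mu\<^sup>2 * energy p e) - mu * (c * energy p e)"
    proof -
      have "mu * (c * energy p e) \<le> mu * (?S + spread A p e / 2)"
        using mu by (intro mult_left_mono c(2)) auto
      moreover have "mu * (spread A p e / 2) \<le> spread A p e / 2"
        using mu spread_nonneg[of e] by (simp add: mult_left_le_one_le)
      moreover have "0 \<le> mu * ?S"
        using mu p_nonneg tau lam(1) by (intro mult_nonneg_nonneg sum_nonneg) (auto simp: less_imp_le)
      ultimately show ?thesis using Ez by (simp add: distrib_left)
    qed
    also have "\<dots> = (1 - c * mu + 2 * L\<^sup>2 * mu\<^sup>2) * energy p e"
      by (simp add: algebra_simps)
    finally show ?thesis .
  qed
  then show ?thesis using that c(1) by blast
qed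

end

section \<open>Fourth moments under one stochastic step\<close>

text \<open>
  The only term kept exactly is the one linear in \<open>y\<close>, as its expectation will vanish. The mixed
  quadratic term goes by Young's inequality, with a parameter \<open>r\<close> that will be of the order of
  the step-size; this is why the noise enters with the factor \<open>16 / r\<close>.
\<close>

lemma norm_pow4_add_le:
  fixes x y :: "'a::real_inner"
  assumes "0 < r"
  shows "norm (x + y) ^ 4 \<le> (1 + r) * norm x ^ 4 + 4 * ((norm x)\<^sup>2 * (x \<bullet> y)) + (3 + 16 / r) * norm y ^ 4"
proof -
  define a b i where "a = norm x" and "b = norm y" and "i = x \<bullet> y"
  have ab: "0 \<le> a" "0 \<le> b" unfolding a_def b_def by auto
  have i: "\<bar>i\<bar> \<le> a * b" unfolding a_def b_def i_def by (rule Cauchy_Schwarz_ineq2)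
  have "(norm (x + y))\<^sup>2 = a\<^sup>2 + 2 * i + b\<^sup>2"
    by (simp add: power2_norm_eq_inner inner_add_left inner_add_right inner_commute a_def b_def i_def)
  then have "norm (x + y) ^ 4 = (a\<^sup>2 + 2 * i + b\<^sup>2)\<^sup>2"
    by (metis (no_types) numeral_Bit0_eq_double power_mult numeral_times_numeral mult_2 num_double)
  also have "\<dots> = a^4 + 4 * (a\<^sup>2 * i) + 4 * i\<^sup>2 + 2 * a\<^sup>2 * b\<^sup>2 + 4 * i * b\<^sup>2 + b^4"
    by (simp add: power2_eq_square power4_eq_xxxx algebra_simps)
  also have "\<dots> \<le> a^4 + 4 * (a\<^sup>2 * i) + 8 * (a\<^sup>2 * b\<^sup>2) + 3 * b^4"
  proof -
    have "i\<^sup>2 \<le> (a * b)\<^sup>2" using i by (simp add: abs_le_square_iff[symmetric] ab)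
    then have 1: "i\<^sup>2 \<le> a\<^sup>2 * b\<^sup>2" by (simp add: power_mult_distrib)
    have "i * b\<^sup>2 \<le> a * b * b\<^sup>2" using i by (intro mult_right_mono) auto
    moreover have "0 \<le> b\<^sup>2 * (a - b)\<^sup>2" by simp
    ultimately have 2: "2 * (i * b\<^sup>2) \<le> a\<^sup>2 * b\<^sup>2 + b ^ 4"
      by (simp add: power2_eq_square power4_eq_xxxx algebra_simps)
    show ?thesis using 1 2 by linarith
  qed
  also have "8 * (a\<^sup>2 * b\<^sup>2) \<le> r * a^4 + 16 / r * b^4"
  proof -
    have "0 \<le> (r * a\<^sup>2 - 4 * b\<^sup>2)\<^sup>2" by simp
    then have "8 * (a\<^sup>2 * b\<^sup>2) * r \<le> (r * a^4 + 16 / r * b^4) * r"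
      using assms by (simp add: power2_eq_square power4_eq_xxxx algebra_simps)
    then show ?thesis using assms by (simp only: mult_le_cancel_right_pos)
  qed
  finally show ?thesis
    unfolding a_def b_def i_def by (simp add: algebra_simps)
qed

lemma Young_four_thirds:
  fixes a b :: real
  assumes "0 \<le> a" "0 \<le> b"
  shows "a ^ 3 * b \<le> a ^ 4 + b ^ 4"
proof (cases "a \<le> b")
  case True
  then have "a ^ 3 * b \<le> b ^ 3 * b" using assms by (intro mult_right_mono power_mono) auto
  moreover have "b ^ 3 * b = b ^ 4" by (simp add: power_numeral_reduce)
  moreover have "0 \<le> a ^ 4" by simp
  ultimately show ?thesis by linarith
next
  case False
  then have "a ^ 3 * b \<le> a ^ 3 * a" using assms by (intro mult_left_mono) auto
  moreover have "a ^ 3 * a = a ^ 4" by (simp add: power_numeral_reduce)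
  moreover have "0 \<le> b ^ 4" by simp
  ultimately show ?thesis by linarith
qed

lemma borel_measurable_component [measurable (raw)]:
  fixes f :: "'a \<Rightarrow> real^'p::finite"
  assumes "f \<in> borel_measurable N"
  shows "(\<lambda>x. f x $ q) \<in> borel_measurable N"
  by (rule measurable_compose[OF assms])
    (intro borel_measurable_continuous_onI continuous_on_component continuous_on_id)

context prob_space
begin

lemma sigma_finite_subalgebra_of_subalgebra: "subalgebra M G \<Longrightarrow> sigma_finite_subalgebra M G"
  by (intro finite_measure_subalgebra_is_sigma_finite finite_measure_subalgebra.intro
      finite_measure_axioms finite_measure_subalgebra_axioms.intro)

text \<open>
  The conditional expectation pulls out each component of \<open>z\<close>. Only the product has to be integrable,
  which matters because \<open>z\<close> will be cubic in the error.
\<close>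

lemma expectation_inner_centered:
  fixes z s :: "'a \<Rightarrow> real^'p::finite"
  assumes sub: "subalgebra M G"
    and z: "z \<in> borel_measurable G" and s: "s \<in> borel_measurable M"
    and centered: "AE \<omega> in M. cond_mean M G s \<omega> = 0"
    and int: "integrable M (\<lambda>\<omega>. norm (z \<omega>) * norm (s \<omega>))"
  shows "integrable M (\<lambda>\<omega>. z \<omega> \<bullet> s \<omega>)" and "expectation (\<lambda>\<omega>. z \<omega> \<bullet> s \<omega>) = 0"
proof -
  interpret sigma_finite_subalgebra M G
    by (rule sigma_finite_subalgebra_of_subalgebra[OF sub])
  have zM [measurable]: "z \<in> borel_measurable M" by (rule measurable_from_subalg[OF sub z])
  note s [measurable]
  have comp: "integrable M (\<lambda>\<omega>. z \<omega> $ q * s \<omega> $ q)" for q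
  proof (rule Bochner_Integration.integrable_bound[OF int])
    show "(\<lambda>\<omega>. z \<omega> $ q * s \<omega> $ q) \<in> borel_measurable M" by measurable
    show "AE \<omega> in M. norm (z \<omega> $ q * s \<omega> $ q) \<le> norm (norm (z \<omega>) * norm (s \<omega>))"
      by (simp add: abs_mult mult_mono component_le_norm_cart)
  qed
  have "expectation (\<lambda>\<omega>. z \<omega> $ q * s \<omega> $ q) = 0" for q
  proof -
    have zq: "(\<lambda>\<omega>. z \<omega> $ q) \<in> borel_measurable G"
      using z by measurable
    have sq: "(\<lambda>\<omega>. s \<omega> $ q) \<in> borel_measurable M" by measurable
    have "expectation (\<lambda>\<omega>. z \<omega> $ q * s \<omega> $ q)
        = expectation (\<lambda>\<omega>. z \<omega> $ q * real_cond_exp M G (\<lambda>\<omega>. s \<omega> $ q) \<omega>)"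
      using real_cond_exp_intg(2)[OF comp zq sq] by simp
    also have "\<dots> = expectation (\<lambda>\<omega>. 0)"
    proof (rule integral_cong_AE)
      show "AE \<omega> in M. z \<omega> $ q * real_cond_exp M G (\<lambda>\<omega>. s \<omega> $ q) \<omega> = 0"
        using centered by eventually_elim (simp add: cond_mean_def vec_eq_iff)
    qed (use zM in measurable)
    finally show ?thesis by simp
  qed
  then show "integrable M (\<lambda>\<omega>. z \<omega> \<bullet> s \<omega>)" "expectation (\<lambda>\<omega>. z \<omega> \<bullet> s \<omega>) = 0"
    using comp by (simp_all add: inner_vec_def)
qed

text \<open>
  The cross term is the inner product of \<open>s\<close> with the vector \<open>(norm u)\<^sup>2 *\<^sub>R adjoint B u\<close>, which is known
  before \<open>s\<close> is drawn, and therefore has zero mean. Only the unconditional fourth moment of \<open>s\<close>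
  is left.
\<close>

lemma fourth_moment_step:
  fixes u :: "'a \<Rightarrow> 'q::euclidean_space" and s :: "'a \<Rightarrow> real^'p::finite"
  assumes sub: "subalgebra M G"
    and u: "u \<in> borel_measurable G" and s: "s \<in> borel_measurable M"
    and centered: "AE \<omega> in M. cond_mean M G s \<omega> = 0"
    and int_u: "integrable M (\<lambda>\<omega>. norm (u \<omega>) ^ 4)"
    and int_s: "integrable M (\<lambda>\<omega>. norm (s \<omega>) ^ 4)"
    and B: "linear B" and bound: "\<And>v. norm (B v) \<le> K * norm v"
    and r: "0 < r"
  shows "integrable M (\<lambda>\<omega>. norm (u \<omega> + B (s \<omega>)) ^ 4)"
    and "expectation (\<lambda>\<omega>. norm (u \<omega> + B (s \<omega>)) ^ 4)
      \<le> (1 + r) * expectation (\<lambda>\<omega>. norm (u \<omega>) ^ 4)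
        + (3 + 16 / r) * K ^ 4 * expectation (\<lambda>\<omega>. norm (s \<omega>) ^ 4)"
proof -
  have uM [measurable]: "u \<in> borel_measurable M" by (rule measurable_from_subalg[OF sub u])
  note s [measurable]
  have Bm [measurable]: "B \<in> borel_measurable borel"
    using B by (intro borel_measurable_continuous_onI linear_continuous_on)
      (simp add: linear_conv_bounded_linear)
  define z where "z \<omega> = (norm (u \<omega>))\<^sup>2 *\<^sub>R adjoint B (u \<omega>)" for \<omega>
  have adj: "linear (adjoint B)" by (rule adjoint_linear[OF B])
  have "adjoint B \<in> borel_measurable borel"
    using adj by (intro borel_measurable_continuous_onI linear_continuous_on)
      (simp add: linear_conv_bounded_linear)
  then have z: "z \<in> borel_measurable G"
    unfolding z_def using u by measurable
  have zM [measurable]: "z \<in> borel_measurable M" by (rule measurable_from_subalg[OF sub z])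
  obtain K' where K': "\<And>v. norm (adjoint B v) \<le> K' * norm v" "0 < K'"
    using linear_bounded_pos[OF adj] by blast
  have int_zs: "integrable M (\<lambda>\<omega>. norm (z \<omega>) * norm (s \<omega>))"
  proof (rule Bochner_Integration.integrable_bound)
    show "integrable M (\<lambda>\<omega>. K' * (norm (u \<omega>) ^ 4 + norm (s \<omega>) ^ 4))"
      using int_u int_s by simp
    show "AE \<omega> in M. norm (norm (z \<omega>) * norm (s \<omega>))
        \<le> norm (K' * (norm (u \<omega>) ^ 4 + norm (s \<omega>) ^ 4))"
    proof (intro AE_I2)
      fix \<omega>
      have "norm (z \<omega>) * norm (s \<omega>) \<le> (norm (u \<omega>))\<^sup>2 * (K' * norm (u \<omega>)) * norm (s \<omega>)"
        unfolding z_def by (auto intro!: mult_right_mono mult_left_mono K')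
      also have "\<dots> = K' * (norm (u \<omega>) ^ 3 * norm (s \<omega>))"
        by (simp add: power_numeral_reduce mult_ac)
      also have "\<dots> \<le> K' * (norm (u \<omega>) ^ 4 + norm (s \<omega>) ^ 4)"
        using K' by (intro mult_left_mono Young_four_thirds) auto
      finally show "norm (norm (z \<omega>) * norm (s \<omega>))
          \<le> norm (K' * (norm (u \<omega>) ^ 4 + norm (s \<omega>) ^ 4))"
        using K' by simp
    qed
  qed measurable
  note c = expectation_inner_centered[OF sub z s centered int_zs]
  have K: "norm (B v) ^ 4 \<le> K ^ 4 * norm v ^ 4" for v
    using power_mono[OF bound norm_ge_zero, of v 4] by (simp add: power_mult_distrib)
  have pw: "norm (u \<omega> + B (s \<omega>)) ^ 4 \<le> (1 + r) * norm (u \<omega>) ^ 4 + 4 * (z \<omega> \<bullet> s \<omega>)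
        + (3 + 16 / r) * K ^ 4 * norm (s \<omega>) ^ 4" for \<omega>
  proof -
    have "z \<omega> \<bullet> s \<omega> = (norm (u \<omega>))\<^sup>2 * (u \<omega> \<bullet> B (s \<omega>))"
      unfolding z_def using adjoint_works[OF B, of "s \<omega>" "u \<omega>"] by (simp add: inner_commute)
    moreover have "(3 + 16 / r) * norm (B (s \<omega>)) ^ 4 \<le> (3 + 16 / r) * (K ^ 4 * norm (s \<omega>) ^ 4)"
      using r by (intro mult_left_mono K) auto
    ultimately show ?thesis
      using norm_pow4_add_le[OF r, of "u \<omega>" "B (s \<omega>)"] by (simp add: mult.assoc)
  qed
  let ?f = "\<lambda>\<omega>. (1 + r) * norm (u \<omega>) ^ 4 + 4 * (z \<omega> \<bullet> s \<omega>)
        + (3 + 16 / r) * K ^ 4 * norm (s \<omega>) ^ 4"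
  have int_f: "integrable M ?f"
    using int_u int_s c(1) by simp
  show int: "integrable M (\<lambda>\<omega>. norm (u \<omega> + B (s \<omega>)) ^ 4)"
  proof (rule Bochner_Integration.integrable_bound[OF int_f])
    show "AE \<omega> in M. norm (norm (u \<omega> + B (s \<omega>)) ^ 4) \<le> norm (?f \<omega>)"
      using pw by (intro AE_I2) (auto intro: order_trans[OF pw abs_ge_self])
  qed measurable
  have "expectation (\<lambda>\<omega>. norm (u \<omega> + B (s \<omega>)) ^ 4) \<le> expectation ?f"
    by (rule integral_mono[OF int int_f pw])
  also have "\<dots> = (1 + r) * expectation (\<lambda>\<omega>. norm (u \<omega>) ^ 4)
        + (3 + 16 / r) * K ^ 4 * expectation (\<lambda>\<omega>. norm (s \<omega>) ^ 4)"
    using int_u int_s c by simp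
  finally show "expectation (\<lambda>\<omega>. norm (u \<omega> + B (s \<omega>)) ^ 4)
      \<le> (1 + r) * expectation (\<lambda>\<omega>. norm (u \<omega>) ^ 4)
        + (3 + 16 / r) * K ^ 4 * expectation (\<lambda>\<omega>. norm (s \<omega>) ^ 4)" .
qed

end

text \<open>
  The excess of \<open>x i\<close> over the fixed point \<open>b / a\<close> shrinks by the factor \<open>1 - a\<close> in each step.
\<close>

lemma limsup_affine_recursion:
  fixes x :: "nat \<Rightarrow> real"
  assumes step: "\<And>i. x (Suc i) \<le> (1 - a) * x i + b" and a: "0 < a" "a \<le> 1"
  shows "limsup (\<lambda>i. ennreal (x i)) \<le> ennreal (b / a)"
proof -
  have bnd: "x i - b / a \<le> (1 - a) ^ i * (x 0 - b / a)" for i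
  proof (induction i)
    case (Suc i)
    have "x (Suc i) - b / a \<le> (1 - a) * (x i - b / a)"
    proof -
      have "b = a * (b / a)" using a by simp
      then show ?thesis using step[of i] by (simp only: algebra_simps)
    qed
    also have "\<dots> \<le> (1 - a) * ((1 - a) ^ i * (x 0 - b / a))"
      using Suc a by (intro mult_left_mono) auto
    finally show ?case by (simp add: mult.assoc)
  qed simp
  have "(\<lambda>i. (1 - a) ^ i * (x 0 - b / a) + b / a) \<longlonglongrightarrow> 0 * (x 0 - b / a) + b / a"
    using a by (intro tendsto_intros LIMSEQ_power_zero) auto
  then have lim: "(\<lambda>i. ennreal ((1 - a) ^ i * (x 0 - b / a) + b / a)) \<longlonglongrightarrow> ennreal (b / a)"
    by (intro tendsto_ennrealI) simp
  have "limsup (\<lambda>i. ennreal (x i)) \<le> limsup (\<lambda>i. ennreal ((1 - a) ^ i * (x 0 - b / a) + b / a))"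
    using bnd by (intro Limsup_mono always_eventually allI ennreal_leI) (simp add: algebra_simps)
  also have "\<dots> = ennreal (b / a)"
    using lim by (intro lim_imp_Limsup) auto
  finally show ?thesis .
qed

section \<open>Noise and error dynamics\<close>

text \<open>
  Integration of the conditional bound. The extended nonnegative conditional expectation gives
  integrability of the noise along with the inequality.
\<close>

lemma (in gradient_noise) expected_noise_fourth_moment:
  assumes w: "w \<in> borel_measurable (F i)"
    and int: "integrable M (\<lambda>\<omega>. norm (col wo - w \<omega>) ^ 4)"
  shows "integrable M (\<lambda>\<omega>. norm (grad_noise J ghat i \<omega> (w \<omega>)) ^ 4)"
    and "expectation (\<lambda>\<omega>. norm (grad_noise J ghat i \<omega> (w \<omega>)) ^ 4)
      \<le> alpha\<^sup>2 * expectation (\<lambda>\<omega>. norm (col wo - w \<omega>) ^ 4) + sigma ^ 4"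
proof -
  interpret S: sigma_finite_subalgebra M "F i"
    by (rule sigma_finite_subalgebra_of_subalgebra[OF subalg])
  let ?s = "\<lambda>\<omega>. norm (grad_noise J ghat i \<omega> (w \<omega>)) ^ 4"
  let ?b = "\<lambda>\<omega>. alpha\<^sup>2 * norm (col wo - w \<omega>) ^ 4 + sigma ^ 4"
  have [measurable]: "?s \<in> borel_measurable M"
    using noise_measurable[OF w] by measurable
  have "(\<integral>\<^sup>+\<omega>. ennreal (?s \<omega>) \<partial>M) = (\<integral>\<^sup>+\<omega>. nn_cond_exp M (F i) (\<lambda>\<omega>. ennreal (?s \<omega>)) \<omega> \<partial>M)"
    using S.nn_cond_exp_intg[of "\<lambda>_. 1" "\<lambda>\<omega>. ennreal (?s \<omega>)"] by simp
  also have "\<dots> \<le> (\<integral>\<^sup>+\<omega>. ennreal (?b \<omega>) \<partial>M)"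
    by (rule nn_integral_mono_AE[OF noise_fourth_moment[OF w]])
  also have "\<dots> = ennreal (expectation ?b)"
    using int by (intro nn_integral_eq_integral) auto
  finally have le: "(\<integral>\<^sup>+\<omega>. ennreal (?s \<omega>) \<partial>M) \<le> ennreal (expectation ?b)" .
  show int_s: "integrable M ?s"
    by (rule integrableI_nonneg) (use le in \<open>auto intro: le_less_trans\<close>)
  have "ennreal (expectation ?s) \<le> ennreal (expectation ?b)"
    using le nn_integral_eq_integral[OF int_s] by simp
  moreover have "0 \<le> expectation ?b" by (rule integral_nonneg_AE) simp
  ultimately have "expectation ?s \<le> expectation ?b" by simp
  also have "\<dots> = alpha\<^sup>2 * expectation (\<lambda>\<omega>. norm (col wo - w \<omega>) ^ 4) + sigma ^ 4"
    using int by (simp add: prob_space)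
  finally show "expectation ?s \<le> \<dots>" .
qed

text \<open>
  The stacked negative gradients as a function of the error. It equals the averaged Hessian applied to
  the error, but its continuity, hence measurability along the iterates, is immediate.
\<close>

definition restoring_field ::
  "('n::finite \<Rightarrow> real^'m::finite \<Rightarrow> real) \<Rightarrow> ('n \<Rightarrow> real^'m) \<Rightarrow> real^('n \<times> 'm) \<Rightarrow> real^('n \<times> 'm)" where
  "restoring_field J wo e = col (\<lambda>k. - gradient (J k) (wo k - block k e))"

context cost_model
begin

text \<open>
  The Lipschitz bound on the block diagonal matrix, tested on stacked vectors that are zero outside
  block \<open>k\<close>, bounds each entry of the Hessian of \<open>J k\<close>.
\<close>

lemma continuous_hessian: "continuous_on S (hessian (J k))"
proof (rule continuous_on_matrix[OF kappaH_nonneg])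
  fix u v :: "real^'m" and i j
  define x where "x u = col (\<lambda>l. if l = k then u else (0 :: real^'m))" for u
  let ?D = "\<lambda>u. block_diag (\<lambda>l. hessian (J l) (block l (x u)))"
  have "(hessian (J k) u $ i $ j - hessian (J k) v $ i $ j) = (?D u - ?D v) $ (k, i) $ (k, j)"
    by (simp add: block_diag_def x_def)
  also have "\<bar>\<dots>\<bar> \<le> mat_norm (?D u - ?D v)"
    unfolding mat_norm_def by (rule matrix_component_le_onorm)
  also have "\<dots> \<le> kappaH * norm (x u - x v)"
    by (rule hessian_lipschitz)
  also have "norm (x u - x v) = norm (u - v)"
  proof -
    have "(norm (x u - x v))\<^sup>2 = (\<Sum>l\<in>UNIV. if l = k then (norm (u - v))\<^sup>2 else 0)"
      unfolding norm_blocks by (intro sum.cong) (auto simp: x_def)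
    then show ?thesis by simp
  qed
  finally show "\<bar>hessian (J k) u $ i $ j - hessian (J k) v $ i $ j\<bar> \<le> kappaH * dist u v"
    by (simp add: dist_norm)
qed

lemma gradient_wo: "gradient (J k) (wo k) = 0"
  by (rule gradient_at_minimizer[OF twice_diff minimizer])

lemma mean_hessian_eq_restoring_field: "mean_hessian J wo e *v e = restoring_field J wo e"
  by (rule block_eqI)
    (simp add: mean_hessian_def block_block_diag restoring_field_def gradient_wo
      averaged_hessian(2)[OF twice_diff continuous_hessian])

lemma restoring_field_bounds:
  shows "lamL k * (norm (block k e))\<^sup>2 \<le> block k e \<bullet> block k (restoring_field J wo e)"
    and "norm (block k (restoring_field J wo e)) \<le> (\<Sum>l\<in>UNIV. lamU l) * norm (block k e)"
proof -
  note b = gradient_monotone_and_lipschitz[OF twice_diff[of k] continuous_hessian hessian_lower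
      hessian_upper, where e = "block k e" and x = "wo k"]
  show "lamL k * (norm (block k e))\<^sup>2 \<le> block k e \<bullet> block k (restoring_field J wo e)"
    using b(1) lam_bounds[of k] by (simp add: restoring_field_def gradient_wo)
  have "lamU k \<le> (\<Sum>l\<in>UNIV. lamU l)"
    using lam_bounds by (intro member_le_sum) (auto intro: order_trans)
  then have "lamU k * norm (block k e) \<le> (\<Sum>l\<in>UNIV. lamU l) * norm (block k e)"
    by (intro mult_right_mono) auto
  then show "norm (block k (restoring_field J wo e)) \<le> (\<Sum>l\<in>UNIV. lamU l) * norm (block k e)"
    using b(2) lam_bounds[of k] by (simp add: restoring_field_def gradient_wo)
qed

lemma continuous_restoring_field: "continuous_on S (restoring_field J wo)"
  unfolding restoring_field_def col_def
  by (intro continuous_intros continuous_on_compose2[OF continuous_gradient[OF twice_diff, of UNIV]]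
      bounded_linear.continuous_on[OF bounded_linear_block]) auto

end

locale diffusion_network =
  grouped_network nbhd clusters groups A + cost_model clusters groups J wo lamL lamU kappaH
  for nbhd :: "'n::{finite,linorder} \<Rightarrow> 'n set"
    and clusters groups :: "'n set set"
    and A :: "((real, 'n) vec, 'n) vec"
    and J :: "'n \<Rightarrow> real^'m::finite \<Rightarrow> real"
    and wo :: "'n \<Rightarrow> real^'m"
    and lamL lamU :: "'n \<Rightarrow> real"
    and kappaH :: real
begin

text \<open>
  A group lies in one cluster, so the average only involves copies of \<open>wo k\<close>. This is why cooperation
  inside groups introduces no bias.
\<close>

lemma weighted_minimizers: "(\<Sum>l\<in>UNIV. A $ l $ k *\<^sub>R wo l) = wo k"
proof -
  have "A $ l $ k *\<^sub>R wo l = A $ l $ k *\<^sub>R wo k" for l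
  proof (cases "l \<in> group_of groups k")
    case True
    obtain c where "c \<in> clusters" "group_of groups k \<subseteq> c"
      using group_in_cluster[OF group_of_mem(1)[OF groups]] by blast
    then have "wo l = wo k"
      using cluster_minimizer[of c l k] True group_of_mem(2)[OF groups, of k] by blast
    then show ?thesis by simp
  qed (simp add: weight_zero)
  then have "(\<Sum>l\<in>UNIV. A $ l $ k *\<^sub>R wo l) = (\<Sum>l\<in>UNIV. A $ l $ k *\<^sub>R wo k)"
    by (rule sum.cong[OF refl])
  then show ?thesis
    by (simp add: left_stochastic flip: scaleR_left.sum)
qed

lemma net_error_step:
  "net_error nbhd groups A mu ghat wo (Suc i) \<omega> =
     mix A (net_error nbhd groups A mu ghat wo i \<omega>
       - ext_steps mu *v restoring_field J wo (net_error nbhd groups A mu ghat wo i \<omega>))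
     + mix A (ext_steps mu *v grad_noise J ghat i \<omega> (net_iterate nbhd groups A mu ghat i \<omega>))"
  (is "?lhs = ?rhs")
proof (rule block_eqI)
  fix k
  let ?w = "iterate nbhd groups A mu ghat i \<omega>"
  let ?psi = "\<lambda>l. ?w l - mu l *\<^sub>R ghat l i \<omega> (?w l)"
  have "(\<Sum>l \<in> nbhd k \<inter> group_of groups k. A $ l $ k *\<^sub>R ?psi l) = (\<Sum>l\<in>UNIV. A $ l $ k *\<^sub>R ?psi l)"
    by (rule sum.mono_neutral_left) (auto simp: weight_zero)
  then have "block k ?lhs = (\<Sum>l\<in>UNIV. A $ l $ k *\<^sub>R wo l) - (\<Sum>l\<in>UNIV. A $ l $ k *\<^sub>R ?psi l)"
    by (simp add: net_error_def net_iterate_def weighted_minimizers Let_def)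
  also have "\<dots> = (\<Sum>l\<in>UNIV. A $ l $ k *\<^sub>R (wo l - ?psi l))"
    by (simp add: sum_subtractf scaleR_diff_right)
  also have "\<dots> = block k ?rhs"
    unfolding block_add block_mix sum.distrib[symmetric]
    by (intro sum.cong refl)
      (simp add: block_ext_steps restoring_field_def grad_noise_def net_error_def net_iterate_def
        algebra_simps)
  finally show "block k ?lhs = block k ?rhs" .
qed

lemma net_error_recursion:
  "net_error nbhd groups A mu ghat wo (Suc i) \<omega> =
     error_matrix A mu J wo (net_error nbhd groups A mu ghat wo i \<omega>)
       *v net_error nbhd groups A mu ghat wo i \<omega>
     + (transpose (ext_combination A) ** ext_steps mu)
       *v grad_noise J ghat i \<omega> (net_iterate nbhd groups A mu ghat i \<omega>)"
  unfolding net_error_step error_matrix_def mix_def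
  by (simp only: matrix_vector_mul_assoc[symmetric] matrix_vector_mult_diff_rdistrib
      matrix_vector_mul_lid mean_hessian_eq_restoring_field)

end

section \<open>Stability\<close>

locale stationary_diffusion =
  stationary_network nbhd clusters groups A p
  + diffusion_network nbhd clusters groups A J wo lamL lamU kappaH
  for nbhd :: "'n::{finite,linorder} \<Rightarrow> 'n set"
    and clusters groups :: "'n set set"
    and A :: "((real, 'n) vec, 'n) vec"
    and p :: "(real, 'n) vec"
    and J :: "'n \<Rightarrow> real^'m::finite \<Rightarrow> real"
    and wo :: "'n \<Rightarrow> real^'m"
    and lamL lamU :: "'n \<Rightarrow> real"
    and kappaH :: real
begin

text \<open>
  The block scaling that makes the energy a squared Euclidean norm, so that the one-step inequality
  for inner product spaces applies.
\<close>

definition embed :: "real^('n \<times> 'm) \<Rightarrow> real^('n \<times> 'm)" where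
  "embed x = ext_steps (\<lambda>k. sqrt (p $ k)) *v x"

lemma linear_embed: "linear embed"
  unfolding embed_def by (rule matrix_vector_mul_linear)

lemma norm_embed: "(norm (embed x))\<^sup>2 = energy p x"
  by (simp add: norm_blocks embed_def block_ext_steps energy_def power_mult_distrib p_nonneg)

lemma norm_embed4: "norm (embed x) ^ 4 = (energy p x)\<^sup>2"
  unfolding norm_embed[symmetric] by (simp flip: power_mult)

lemma norm_le_energy: "Min (range (($) p)) * (norm x)\<^sup>2 \<le> energy p x"
  unfolding energy_def norm_blocks sum_distrib_left
  by (intro sum_mono mult_right_mono Min_le) auto

lemma Min_p_pos: "0 < Min (range (($) p))"
  by (subst Min_gr_iff) (auto simp: p_pos)

lemma fourth_power_le_energy:
  "norm x ^ 4 \<le> (energy p x)\<^sup>2 / (Min (range (($) p)))\<^sup>2"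
proof -
  define q where "q = Min (range (($) p))"
  have q: "0 < q" unfolding q_def by (rule Min_p_pos)
  have "(q * (norm x)\<^sup>2)\<^sup>2 \<le> (energy p x)\<^sup>2"
    unfolding q_def
    by (intro power_mono norm_le_energy mult_nonneg_nonneg less_imp_le[OF Min_p_pos]) simp
  then have "norm x ^ 4 \<le> (energy p x)\<^sup>2 / q\<^sup>2"
    using q by (simp add: power_mult_distrib pos_le_divide_eq mult.commute flip: power_mult)
  then show ?thesis unfolding q_def .
qed

text \<open>
  The one-step inequality with \<open>r = a * mu\<close>: the drift part contributes
  \<open>(1 + a * mu) * (1 - a * mu)\<^sup>2 \<le> 1 - a * mu\<close>, and the noise, scaled by \<open>mu\<close> and penalised by
  \<open>16 / r\<close>, contributes a term of order \<open>mu ^ 4 / mu = mu ^ 3\<close>.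
\<close>

lemma mean_fourth_step:
  fixes M :: "'a measure" and F :: "nat \<Rightarrow> 'a measure"
    and ghat :: "'n \<Rightarrow> nat \<Rightarrow> 'a \<Rightarrow> real^'m \<Rightarrow> real^'m"
    and alpha sigma kappaS gammaS mu a :: real and tau :: "'n \<Rightarrow> real"
  defines "err \<equiv> net_error nbhd groups A (\<lambda>k. tau k * mu) ghat wo"
  assumes noise: "gradient_noise M F J wo ghat alpha sigma kappaS gammaS Rs"
    and adapted: "\<And>i. net_iterate nbhd groups A (\<lambda>k. tau k * mu) ghat i \<in> borel_measurable (F i)"
    and tau: "\<And>k. 0 < tau k \<and> tau k \<le> 1"
    and mu: "0 < mu" "mu \<le> 1" and a: "0 < a" "a * mu \<le> 1"
    and contraction: "\<And>e. energy p (mix A (e - ext_steps (\<lambda>k. tau k * mu) *v restoring_field J wo e))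
            \<le> (1 - a * mu) * energy p e"
  shows "integrable M (\<lambda>\<omega>. (energy p (err i \<omega>))\<^sup>2)"
    and "(\<integral>\<omega>. (energy p (err (Suc i) \<omega>))\<^sup>2 \<partial>M)
      \<le> (1 - a * mu) * (\<integral>\<omega>. (energy p (err i \<omega>))\<^sup>2 \<partial>M)
        + (3 + 16 / a) * (\<Sum>k\<in>UNIV. p $ k)\<^sup>2 * (alpha\<^sup>2 / (Min (range (($) p)))\<^sup>2 + sigma ^ 4)
          * mu ^ 3 * (1 + (\<integral>\<omega>. (energy p (err i \<omega>))\<^sup>2 \<partial>M))"
proof -
  interpret N: gradient_noise M F J wo ghat alpha sigma kappaS gammaS Rs by (rule noise)
  let ?w = "net_iterate nbhd groups A (\<lambda>k. tau k * mu) ghat"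
  let ?P = "\<Sum>k\<in>UNIV. p $ k" and ?q = "Min (range (($) p))"
  define f where "f e = embed (mix A (e - ext_steps (\<lambda>k. tau k * mu) *v restoring_field J wo e))" for e
  define B where "B v = embed (mix A (ext_steps (\<lambda>k. tau k * mu) *v v))" for v
  define s where "s i \<omega> = grad_noise J ghat i \<omega> (?w i \<omega>)" for i \<omega>
  have P: "0 \<le> ?P" by (intro sum_nonneg p_nonneg)
  have lin_em: "linear (\<lambda>v. embed (mix A v))"
    unfolding embed_def mix_def matrix_vector_mul_assoc by (rule matrix_vector_mul_linear)
  have B: "linear B"
    unfolding B_def embed_def mix_def matrix_vector_mul_assoc by (rule matrix_vector_mul_linear)
  have step: "embed (err (Suc i) \<omega>) = f (err i \<omega>) + B (s i \<omega>)" for i \<omega>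
    unfolding err_def net_error_step f_def B_def s_def by (rule linear_add[OF linear_embed])
  have "continuous_on UNIV f"
    unfolding f_def
    by (rule continuous_on_compose2[OF linear_continuous_on, of "\<lambda>v. embed (mix A v)" UNIV])
      (auto intro!: lin_em[unfolded linear_conv_bounded_linear] continuous_intros
        continuous_restoring_field
        continuous_on_compose2[OF linear_continuous_on[OF matrix_vector_mul_bounded_linear], of UNIV])
  then have f: "f \<in> borel_measurable borel"
    by (rule borel_measurable_continuous_onI)
  have err: "err i \<in> borel_measurable (F i)" for i
    unfolding err_def net_error_def using adapted[of i] by measurable
  have u: "(\<lambda>\<omega>. f (err i \<omega>)) \<in> borel_measurable (F i)" for i
    by (rule measurable_compose[OF err f])
  have f4: "norm (f e) ^ 4 \<le> (1 - a * mu)\<^sup>2 * (energy p e)\<^sup>2" for e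
    unfolding f_def norm_embed4 power_mult_distrib[symmetric]
    by (intro power_mono contraction energy_nonneg)
  have Bbound: "norm (B v) \<le> sqrt ?P * mu * norm v" for v
  proof (rule power2_le_imp_le)
    have "(norm (B v))\<^sup>2 = energy p (mix A (ext_steps (\<lambda>k. tau k * mu) *v v))"
      unfolding B_def by (rule norm_embed)
    also have "\<dots> \<le> energy p (ext_steps (\<lambda>k. tau k * mu) *v v)"
      using energy_mix[of "ext_steps (\<lambda>k. tau k * mu) *v v"] spread_nonneg by simp
    also have "\<dots> \<le> energy p (mu *\<^sub>R v)"
      unfolding energy_def block_ext_steps block_scaleR
      using tau mu by (intro sum_mono mult_left_mono power_mono)
        (auto simp: p_nonneg abs_mult less_imp_le mult_left_le_one_le)
    also have "\<dots> \<le> ?P * (norm (mu *\<^sub>R v))\<^sup>2" by (rule energy_le_norm)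
    also have "\<dots> = (sqrt ?P * mu * norm v)\<^sup>2"
      using P by (simp add: power_mult_distrib)
    finally show "(norm (B v))\<^sup>2 \<le> (sqrt ?P * mu * norm v)\<^sup>2" .
  qed (use P mu in auto)
  have errM: "(\<lambda>\<omega>. g (err i \<omega>)) \<in> borel_measurable M" if "continuous_on UNIV g"
    for g :: "real^('n \<times> 'm) \<Rightarrow> real" and i
    using measurable_compose[OF measurable_from_subalg[OF N.subalg err]
        borel_measurable_continuous_onI[OF that]] .
  have e4: "integrable M (\<lambda>\<omega>. norm (err i \<omega>) ^ 4)"
    and u4: "integrable M (\<lambda>\<omega>. norm (f (err i \<omega>)) ^ 4)"
    if int: "integrable M (\<lambda>\<omega>. (energy p (err i \<omega>))\<^sup>2)" for i
  proof -
    show "integrable M (\<lambda>\<omega>. norm (err i \<omega>) ^ 4)"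
    proof (rule Bochner_Integration.integrable_bound)
      show "integrable M (\<lambda>\<omega>. (energy p (err i \<omega>))\<^sup>2 / ?q\<^sup>2)" using int by simp
      show "AE \<omega> in M. norm (norm (err i \<omega>) ^ 4) \<le> norm ((energy p (err i \<omega>))\<^sup>2 / ?q\<^sup>2)"
        using fourth_power_le_energy by (intro AE_I2) simp
    qed (intro errM continuous_intros)
    show "integrable M (\<lambda>\<omega>. norm (f (err i \<omega>)) ^ 4)"
    proof (rule Bochner_Integration.integrable_bound)
      show "integrable M (\<lambda>\<omega>. (1 - a * mu)\<^sup>2 * (energy p (err i \<omega>))\<^sup>2)" using int by simp
      show "AE \<omega> in M. norm (norm (f (err i \<omega>)) ^ 4)
          \<le> norm ((1 - a * mu)\<^sup>2 * (energy p (err i \<omega>))\<^sup>2)"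
        using f4 by (intro AE_I2) simp
    qed (intro errM continuous_intros \<open>continuous_on UNIV f\<close>)
  qed
  have s4: "integrable M (\<lambda>\<omega>. norm (s i \<omega>) ^ 4)"
    "(\<integral>\<omega>. norm (s i \<omega>) ^ 4 \<partial>M) \<le> alpha\<^sup>2 * (\<integral>\<omega>. norm (err i \<omega>) ^ 4 \<partial>M) + sigma ^ 4"
    if int: "integrable M (\<lambda>\<omega>. (energy p (err i \<omega>))\<^sup>2)" for i
    using N.expected_noise_fourth_moment[OF adapted, of i] e4[OF int]
    unfolding s_def err_def net_error_def by auto
  note one_step = N.fourth_moment_step[OF N.subalg u N.noise_measurable[OF adapted, folded s_def]
      N.noise_mean[OF adapted, folded s_def] u4 s4(1) B Bbound,
      where r = "a * mu", folded step, unfolded norm_embed4]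
  have int: "integrable M (\<lambda>\<omega>. (energy p (err i \<omega>))\<^sup>2)" for i
  proof (induction i)
    case 0
    then show ?case
      by (simp add: err_def net_error_def net_iterate_def)
  next
    case (Suc i)
    show ?case using one_step(1)[OF Suc Suc] a mu by simp
  qed
  show "integrable M (\<lambda>\<omega>. (energy p (err i \<omega>))\<^sup>2)" by (rule int)
  define X where "X = (\<integral>\<omega>. (energy p (err i \<omega>))\<^sup>2 \<partial>M)"
  have X: "0 \<le> X" unfolding X_def by (rule integral_nonneg_AE) simp
  have "(\<integral>\<omega>. norm (f (err i \<omega>)) ^ 4 \<partial>M) \<le> (\<integral>\<omega>. (1 - a * mu)\<^sup>2 * (energy p (err i \<omega>))\<^sup>2 \<partial>M)"
    using f4 by (intro integral_mono u4 int) (simp add: int)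
  then have U: "(\<integral>\<omega>. norm (f (err i \<omega>)) ^ 4 \<partial>M) \<le> (1 - a * mu)\<^sup>2 * X"
    by (simp add: X_def)
  have "(\<integral>\<omega>. norm (err i \<omega>) ^ 4 \<partial>M) \<le> (\<integral>\<omega>. (energy p (err i \<omega>))\<^sup>2 / ?q\<^sup>2 \<partial>M)"
    by (intro integral_mono e4 int fourth_power_le_energy) (simp add: int)
  then have "(\<integral>\<omega>. norm (err i \<omega>) ^ 4 \<partial>M) \<le> X / ?q\<^sup>2"
    by (simp add: X_def)
  then have "alpha\<^sup>2 * (\<integral>\<omega>. norm (err i \<omega>) ^ 4 \<partial>M) \<le> alpha\<^sup>2 * (X / ?q\<^sup>2)"
    by (rule mult_left_mono) simp
  then have "(\<integral>\<omega>. norm (s i \<omega>) ^ 4 \<partial>M) \<le> alpha\<^sup>2 / ?q\<^sup>2 * X + sigma ^ 4"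
    using s4(2)[OF int[of i]] by simp
  also have "\<dots> \<le> (alpha\<^sup>2 / ?q\<^sup>2 + sigma ^ 4) * (1 + X)"
  proof -
    have "0 \<le> alpha\<^sup>2 / ?q\<^sup>2" "0 \<le> sigma ^ 4 * X" using X by auto
    then show ?thesis by (simp only: distrib_left distrib_right mult_1_right)
  qed
  finally have S: "(\<integral>\<omega>. norm (s i \<omega>) ^ 4 \<partial>M) \<le> (alpha\<^sup>2 / ?q\<^sup>2 + sigma ^ 4) * (1 + X)" .
  \<comment> \<open>the power of \<open>mu\<close> lost to \<open>r = a * mu\<close> leaves order \<open>mu ^ 3\<close>\<close>
  have coef: "(3 + 16 / (a * mu)) * (sqrt ?P * mu) ^ 4 \<le> (3 + 16 / a) * ?P\<^sup>2 * mu ^ 3"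
  proof -
    have "(3 + 16 / (a * mu)) * mu ^ 4 = 3 * mu ^ 4 + 16 / a * mu ^ 3"
      using mu a by (simp add: field_simps power_numeral_reduce)
    also have "\<dots> \<le> 3 * mu ^ 3 + 16 / a * mu ^ 3"
      using mu power_decreasing[of 3 4 mu] by simp
    finally have "(3 + 16 / (a * mu)) * mu ^ 4 \<le> (3 + 16 / a) * mu ^ 3"
      by (simp add: distrib_right)
    moreover have "sqrt ?P ^ 4 = ?P\<^sup>2"
      using P power_mult[of "sqrt ?P" 2 2] by simp
    ultimately show ?thesis
      using mult_right_mono[of "(3 + 16 / (a * mu)) * mu ^ 4" "(3 + 16 / a) * mu ^ 3" "?P\<^sup>2"]
      by (simp add: power_mult_distrib mult_ac)
  qed
  have "(\<integral>\<omega>. (energy p (err (Suc i) \<omega>))\<^sup>2 \<partial>M)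
      \<le> (1 + a * mu) * (\<integral>\<omega>. norm (f (err i \<omega>)) ^ 4 \<partial>M)
        + (3 + 16 / (a * mu)) * (sqrt ?P * mu) ^ 4 * (\<integral>\<omega>. norm (s i \<omega>) ^ 4 \<partial>M)"
    using one_step(2)[OF int int] a mu by simp
  also have "\<dots> \<le> (1 + a * mu) * ((1 - a * mu)\<^sup>2 * X)
        + (3 + 16 / a) * ?P\<^sup>2 * mu ^ 3 * ((alpha\<^sup>2 / ?q\<^sup>2 + sigma ^ 4) * (1 + X))"
    using a mu P X
    by (intro add_mono mult_mono U S coef order_refl) (auto intro!: mult_nonneg_nonneg integral_nonneg_AE)
  also have "(1 + a * mu) * ((1 - a * mu)\<^sup>2 * X) \<le> (1 - a * mu) * X"
  proof -
    have "0 \<le> (a * mu)\<^sup>2 * ((1 - a * mu) * X)"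
      using a X by (intro mult_nonneg_nonneg) auto
    then show ?thesis by (simp add: power2_eq_square algebra_simps)
  qed
  finally show "(\<integral>\<omega>. (energy p (err (Suc i) \<omega>))\<^sup>2 \<partial>M)
      \<le> (1 - a * mu) * (\<integral>\<omega>. (energy p (err i \<omega>))\<^sup>2 \<partial>M)
        + (3 + 16 / a) * ?P\<^sup>2 * (alpha\<^sup>2 / ?q\<^sup>2 + sigma ^ 4) * mu ^ 3
          * (1 + (\<integral>\<omega>. (energy p (err i \<omega>))\<^sup>2 \<partial>M))"
    unfolding X_def by (simp add: mult_ac)
qed

end

context stationary_diffusion
begin

text \<open>
  The second moment follows from the fourth: the pointwise bound
  \<open>t\<^sup>2 \<le> mu / 2 + t ^ 4 / (2 * mu)\<close> loses nothing in the order of \<open>mu\<close>, because \<open>t ^ 4\<close> is of order \<open>mu\<^sup>2\<close>.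
\<close>

lemma limsup_moments_le:
  fixes e :: "nat \<Rightarrow> 'a \<Rightarrow> real^('n \<times> 'm)" and M :: "'a measure"
  defines "q \<equiv> Min (range (($) p))"
  assumes mu: "0 < mu" and a: "0 < a" "a * mu \<le> 1"
    and int: "\<And>i. integrable M (\<lambda>\<omega>. (energy p (e i \<omega>))\<^sup>2)"
    and M: "prob_space M"
    and meas: "\<And>i. e i \<in> borel_measurable M"
    and D: "0 \<le> D"
    and step: "\<And>i. (\<integral>\<omega>. (energy p (e (Suc i) \<omega>))\<^sup>2 \<partial>M)
      \<le> (1 - a * mu) * (\<integral>\<omega>. (energy p (e i \<omega>))\<^sup>2 \<partial>M) + D * mu ^ 3"
  shows "limsup (\<lambda>i. \<integral>\<^sup>+\<omega>. ennreal (norm (e i \<omega>) ^ 4) \<partial>M) \<le> ennreal (D / (a * q\<^sup>2) * mu\<^sup>2)"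
    and "limsup (\<lambda>i. \<integral>\<^sup>+\<omega>. ennreal (norm (e i \<omega>) ^ 2) \<partial>M) \<le> ennreal ((1 + D / (a * q\<^sup>2)) / 2 * mu)"
proof -
  interpret prob_space M by (rule M)
  define x where "x i = (\<integral>\<omega>. (energy p (e i \<omega>))\<^sup>2 \<partial>M) / q\<^sup>2" for i
  have q: "0 < q" unfolding q_def by (rule Min_p_pos)
  have rec: "x (Suc i) \<le> (1 - a * mu) * x i + D * mu ^ 3 / q\<^sup>2" for i
    using divide_right_mono[OF step[of i], of "q\<^sup>2"] unfolding x_def by (simp add: add_divide_distrib)
  have fourth: "(\<integral>\<^sup>+\<omega>. ennreal (norm (e i \<omega>) ^ 4) \<partial>M) \<le> ennreal (x i)" for i
  proof -
    have "(\<integral>\<^sup>+\<omega>. ennreal (norm (e i \<omega>) ^ 4) \<partial>M) \<le> (\<integral>\<^sup>+\<omega>. ennreal ((energy p (e i \<omega>))\<^sup>2 / q\<^sup>2) \<partial>M)"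
      unfolding q_def by (intro nn_integral_mono ennreal_leI fourth_power_le_energy)
    also have "\<dots> = ennreal (x i)"
      unfolding x_def using int[of i] by (subst nn_integral_eq_integral) auto
    finally show ?thesis .
  qed
  have "limsup (\<lambda>i. \<integral>\<^sup>+\<omega>. ennreal (norm (e i \<omega>) ^ 4) \<partial>M) \<le> limsup (\<lambda>i. ennreal (x i))"
    by (intro Limsup_mono always_eventually allI fourth)
  also have "\<dots> \<le> ennreal ((D * mu ^ 3 / q\<^sup>2) / (a * mu))"
    by (rule limsup_affine_recursion[where x = x, OF rec]) (use a mu in auto)
  also have "(D * mu ^ 3 / q\<^sup>2) / (a * mu) = D / (a * q\<^sup>2) * mu\<^sup>2"
    using mu a q by (simp add: field_simps power_numeral_reduce)
  finally show "limsup (\<lambda>i. \<integral>\<^sup>+\<omega>. ennreal (norm (e i \<omega>) ^ 4) \<partial>M) \<le> ennreal (D / (a * q\<^sup>2) * mu\<^sup>2)" .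
  define y where "y i = mu / 2 + x i / (2 * mu)" for i
  have young: "t\<^sup>2 \<le> mu / 2 + t ^ 4 / (2 * mu)" for t :: real
  proof -
    have "0 \<le> (t\<^sup>2 - mu)\<^sup>2" by simp
    then show ?thesis using mu by (simp add: field_simps power2_eq_square power4_eq_xxxx)
  qed
  have second: "(\<integral>\<^sup>+\<omega>. ennreal (norm (e i \<omega>) ^ 2) \<partial>M) \<le> ennreal (y i)" for i
  proof -
    have "(\<integral>\<^sup>+\<omega>. ennreal (norm (e i \<omega>) ^ 2) \<partial>M)
        \<le> (\<integral>\<^sup>+\<omega>. ennreal (mu / 2 + (energy p (e i \<omega>))\<^sup>2 / q\<^sup>2 / (2 * mu)) \<partial>M)"
    proof (intro nn_integral_mono ennreal_leI)
      fix \<omega>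
      show "norm (e i \<omega>) ^ 2 \<le> mu / 2 + (energy p (e i \<omega>))\<^sup>2 / q\<^sup>2 / (2 * mu)"
        using young[of "norm (e i \<omega>)"] divide_right_mono[OF fourth_power_le_energy[of "e i \<omega>"], of "2 * mu"] mu
        unfolding q_def by linarith
    qed
    also have "\<dots> = ennreal (y i)"
      unfolding x_def y_def using int[of i] mu by (subst nn_integral_eq_integral) (auto simp: prob_space)
    finally show ?thesis .
  qed
  have y_rec: "y (Suc i) \<le> (1 - a * mu) * y i + (a * mu * mu / 2 + D * mu ^ 3 / q\<^sup>2 / (2 * mu))" for i
  proof -
    have "x (Suc i) / (2 * mu) \<le> (1 - a * mu) * (x i / (2 * mu)) + D * mu ^ 3 / q\<^sup>2 / (2 * mu)"
      using divide_right_mono[OF rec[of i], of "2 * mu"] mu by (simp add: add_divide_distrib)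
    moreover have "mu / 2 = (1 - a * mu) * (mu / 2) + a * mu * mu / 2"
      by (simp add: field_simps)
    ultimately show ?thesis unfolding y_def distrib_left by linarith
  qed
  have "limsup (\<lambda>i. \<integral>\<^sup>+\<omega>. ennreal (norm (e i \<omega>) ^ 2) \<partial>M) \<le> limsup (\<lambda>i. ennreal (y i))"
    by (intro Limsup_mono always_eventually allI second)
  also have "\<dots> \<le> ennreal ((a * mu * mu / 2 + D * mu ^ 3 / q\<^sup>2 / (2 * mu)) / (a * mu))"
    by (rule limsup_affine_recursion[where x = y, OF y_rec]) (use a mu in auto)
  also have "(a * mu * mu / 2 + D * mu ^ 3 / q\<^sup>2 / (2 * mu)) / (a * mu) = (1 + D / (a * q\<^sup>2)) / 2 * mu"
    using mu a q by (simp add: field_simps power_numeral_reduce)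
  finally show "limsup (\<lambda>i. \<integral>\<^sup>+\<omega>. ennreal (norm (e i \<omega>) ^ 2) \<partial>M)
      \<le> ennreal ((1 + D / (a * q\<^sup>2)) / 2 * mu)" .
qed

text \<open>
  The constants only depend on the network, the costs, \<open>tau\<close>, \<open>alpha\<close> and \<open>sigma\<close>; the probability space,
  the filtration and the gradient approximations are chosen after them, so that a filtration may
  vary with the step-size.
\<close>

lemma mean_fourth_stability:
  fixes alpha sigma :: real and tau :: "'n \<Rightarrow> real"
  assumes tau: "\<And>k. 0 < tau k \<and> tau k \<le> 1"
  obtains mu0 C where "0 < mu0" "0 < C"
    "\<And>mu (M :: 'a measure) F ghat kappaS gammaS Rs.
       \<lbrakk>0 < mu; mu \<le> mu0; gradient_noise M F J wo ghat alpha sigma kappaS gammaS Rs;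
        \<And>i. net_iterate nbhd groups A (\<lambda>k. tau k * mu) ghat i \<in> borel_measurable (F i)\<rbrakk> \<Longrightarrow>
       limsup (\<lambda>i. \<integral>\<^sup>+\<omega>. ennreal (norm (net_error nbhd groups A (\<lambda>k. tau k * mu) ghat wo i \<omega>) ^ 2) \<partial>M)
         \<le> ennreal (C * mu) \<and>
       limsup (\<lambda>i. \<integral>\<^sup>+\<omega>. ennreal (norm (net_error nbhd groups A (\<lambda>k. tau k * mu) ghat wo i \<omega>) ^ 4) \<partial>M)
         \<le> ennreal (C * mu\<^sup>2)"
proof -
  define L where "L = (\<Sum>l\<in>UNIV. lamU l)"
  have L: "0 \<le> L" unfolding L_def using lam_bounds by (intro sum_nonneg) (auto intro: order_trans)
  have lam: "0 \<le> lamL k" for k using lam_bounds by blast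
  obtain c where c: "0 < c" and contr: "\<And>mu (e :: real^('n \<times> 'm)) y. \<lbrakk>0 \<le> mu; mu \<le> 1;
       \<And>k. norm (block k y) \<le> L * norm (block k e);
       \<And>k. lamL k * (norm (block k e))\<^sup>2 \<le> block k e \<bullet> block k y\<rbrakk> \<Longrightarrow>
     energy p (mix A (e - ext_steps (\<lambda>k. tau k * mu) *v y))
       \<le> (1 - c * mu + 2 * L\<^sup>2 * mu\<^sup>2) * energy p e"
  proof (rule energy_contraction[where tau = tau and lam = lamL, OF tau lam group_strong L])
    fix c
    assume "0 < c" and contr: "\<And>mu (e :: real^('n \<times> 'm)) y. \<lbrakk>0 \<le> mu; mu \<le> 1;
         \<And>k. norm (block k y) \<le> L * norm (block k e);
         \<And>k. lamL k * (norm (block k e))\<^sup>2 \<le> block k e \<bullet> block k y\<rbrakk> \<Longrightarrow>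
       energy p (mix A (e - ext_steps (\<lambda>k. tau k * mu) *v y))
         \<le> (1 - c * mu + 2 * L\<^sup>2 * mu\<^sup>2) * energy p e"
    show thesis by (rule that[OF \<open>0 < c\<close> contr])
  qed
  define q where "q = Min (range (($) p))"
  have q: "0 < q" unfolding q_def by (rule Min_p_pos)
  define a where "a = c / 2"
  have a: "0 < a" using c by (simp add: a_def)
  define D where "D = (3 + 16 / a) * (\<Sum>k\<in>UNIV. p $ k)\<^sup>2 * (alpha\<^sup>2 / q\<^sup>2 + sigma ^ 4)"
  have D: "0 \<le> D" unfolding D_def using a by (intro mult_nonneg_nonneg) auto
  \<comment> \<open>the entries of \<open>mu0\<close> make the second-order terms of drift and noise at most half of the gain\<close>
  define mu0 where "mu0 = Min {1, 1 / a, a / (2 * L\<^sup>2 + 1), a / (2 * D + 1)}"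
  define C where "C = 1 + D / (a / 2 * q\<^sup>2)"
  have mu0: "0 < mu0" unfolding mu0_def using a D by (simp add: add_nonneg_pos)
  have C: "1 \<le> C" unfolding C_def using a D q by simp
  show ?thesis
  proof (rule that[OF mu0, of C])
    show "0 < C" using C by simp
    fix mu and M :: "'a measure" and F ghat kappaS gammaS Rs
    assume mu: "0 < mu" "mu \<le> mu0"
      and noise: "gradient_noise M F J wo ghat alpha sigma kappaS gammaS Rs"
      and adapted: "\<And>i. net_iterate nbhd groups A (\<lambda>k. tau k * mu) ghat i \<in> borel_measurable (F i)"
    interpret N: gradient_noise M F J wo ghat alpha sigma kappaS gammaS Rs by (rule noise)
    let ?e = "net_error nbhd groups A (\<lambda>k. tau k * mu) ghat wo"
    let ?X = "\<lambda>i. \<integral>\<omega>. (energy p (?e i \<omega>))\<^sup>2 \<partial>M"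
    have pos: "0 < 2 * L\<^sup>2 + 1" "0 < 2 * D + 1"
      using D by (simp_all add: add_nonneg_pos)
    have mu1: "mu \<le> 1" and "mu \<le> 1 / a" "mu \<le> a / (2 * L\<^sup>2 + 1)" "mu \<le> a / (2 * D + 1)"
      using mu(2) unfolding mu0_def by simp_all
    then have mua: "a * mu \<le> 1" and muL: "(2 * L\<^sup>2 + 1) * mu \<le> a" and muD: "(2 * D + 1) * mu \<le> a"
      using a pos by (simp_all add: pos_le_divide_eq mult.commute)
    have contraction: "energy p (mix A (e - ext_steps (\<lambda>k. tau k * mu) *v restoring_field J wo e))
        \<le> (1 - a * mu) * energy p e" for e
    proof -
      have "energy p (mix A (e - ext_steps (\<lambda>k. tau k * mu) *v restoring_field J wo e))
          \<le> (1 - c * mu + 2 * L\<^sup>2 * mu\<^sup>2) * energy p e"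
        using mu(1) mu1 restoring_field_bounds unfolding L_def[symmetric] by (intro contr) auto
      also have "\<dots> \<le> (1 - a * mu) * energy p e"
      proof (intro mult_right_mono energy_nonneg)
        have "2 * L\<^sup>2 * mu \<le> a" using muL mu(1) by (simp add: distrib_right)
        then have "2 * L\<^sup>2 * mu * mu \<le> a * mu" using mu(1) by (intro mult_right_mono) auto
        then show "1 - c * mu + 2 * L\<^sup>2 * mu\<^sup>2 \<le> 1 - a * mu"
          unfolding a_def power2_eq_square by (simp add: mult.assoc)
      qed
      finally show ?thesis .
    qed
    note S = mean_fourth_step[OF noise adapted tau mu(1) mu1 a mua contraction, folded q_def, folded D_def]
    have step: "?X (Suc i) \<le> (1 - a / 2 * mu) * ?X i + D * mu ^ 3" for i
    proof -
      have "0 \<le> ?X i" by (rule integral_nonneg_AE) simp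
      moreover have "D * mu ^ 3 \<le> a / 2 * mu"
      proof -
        have "D * mu \<le> a / 2" using muD mu(1) by (simp add: distrib_right)
        moreover have "mu ^ 2 \<le> mu" using mu(1) mu1 by (simp add: power2_eq_square mult_left_le)
        ultimately have "D * mu * mu ^ 2 \<le> a / 2 * mu"
          using D mu(1) a by (intro mult_mono) auto
        then show ?thesis by (simp add: power_numeral_reduce mult.assoc)
      qed
      ultimately have "D * mu ^ 3 * ?X i \<le> a / 2 * mu * ?X i" by (intro mult_right_mono)
      then show ?thesis using S(2)[of i] by (simp add: algebra_simps)
    qed
    have meas: "?e i \<in> borel_measurable M" for i
      unfolding net_error_def using measurable_from_subalg[OF N.subalg adapted[of i]] by measurable
    have "a / 2 * mu \<le> 1" using mua a mu(1) by simp
    note bounds = limsup_moments_le[where e = ?e, OF mu(1) half_gt_zero[OF a] this S(1) N.prob_space_axioms meas D step,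
        folded q_def]
    have "(1 + D / (a / 2 * q\<^sup>2)) / 2 * mu \<le> C * mu"
      unfolding C_def[symmetric] using mu(1) C by (intro mult_right_mono) auto
    moreover have "D / (a / 2 * q\<^sup>2) * mu\<^sup>2 \<le> C * mu\<^sup>2"
      unfolding C_def by (intro mult_right_mono) auto
    ultimately show "limsup (\<lambda>i. \<integral>\<^sup>+\<omega>. ennreal (norm (?e i \<omega>) ^ 2) \<partial>M) \<le> ennreal (C * mu) \<and>
       limsup (\<lambda>i. \<integral>\<^sup>+\<omega>. ennreal (norm (?e i \<omega>) ^ 4) \<partial>M) \<le> ennreal (C * mu\<^sup>2)"
      using order_trans[OF bounds(1) ennreal_leI] order_trans[OF bounds(2) ennreal_leI] by blast
  qed
qed

end

theorem theorem1:
  fixes nbhd :: "'n::{finite,linorder} \<Rightarrow> 'n set"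
    and clusters groups :: "'n set set"
    and A :: "((real, 'n) vec, 'n) vec"
    and J :: "'n \<Rightarrow> real^'m::finite \<Rightarrow> real"
    and wo :: "'n \<Rightarrow> real^'m"
    and lamL lamU tau :: "'n \<Rightarrow> real"
    and kappaH alpha sigma kappaS gammaS :: real
    and Rs :: "real^('n \<times> 'm)^('n \<times> 'm)"
    and M :: "'a measure"
    and F :: "real \<Rightarrow> nat \<Rightarrow> 'a measure"
    and ghat :: "'n \<Rightarrow> nat \<Rightarrow> 'a \<Rightarrow> real^'m \<Rightarrow> real^'m"
  defines "mu \<equiv> \<lambda>mu_max k. tau k * mu_max"
  defines "w \<equiv> \<lambda>mu_max. net_iterate nbhd groups A (mu mu_max) ghat"
  defines "err \<equiv> \<lambda>mu_max. net_error nbhd groups A (mu mu_max) ghat wo"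
  assumes "clustered_network nbhd clusters groups"
    and "combination_matrix nbhd groups A"
    and "cost_model clusters groups J wo lamL lamU kappaH"
    and "\<And>k. 0 < tau k \<and> tau k \<le> 1"
    and "Max (range tau) = 1"
    and "\<And>mu_max. 0 < mu_max \<Longrightarrow>
           gradient_noise M (F mu_max) J wo ghat alpha sigma kappaS gammaS Rs"
    and "\<And>mu_max i. 0 < mu_max \<Longrightarrow> w mu_max i \<in> borel_measurable (F mu_max i)"
  shows "(\<forall>mu_max>0. \<forall>i. \<forall>\<omega>\<in>space M.
            err mu_max (Suc i) \<omega> =
              error_matrix A (mu mu_max) J wo (err mu_max i \<omega>) *v err mu_max i \<omega>
              + (transpose (ext_combination A) ** ext_steps (mu mu_max))
                  *v grad_noise J ghat i \<omega> (w mu_max i \<omega>))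
       \<and> (\<exists>mu0>0. \<exists>C>0. \<forall>mu_max. 0 < mu_max \<and> mu_max \<le> mu0 \<longrightarrow>
            limsup (\<lambda>i. \<integral>\<^sup>+\<omega>. ennreal (norm (err mu_max i \<omega>) ^ 2) \<partial>M) \<le> ennreal (C * mu_max)
          \<and> limsup (\<lambda>i. \<integral>\<^sup>+\<omega>. ennreal (norm (err mu_max i \<omega>) ^ 4) \<partial>M) \<le> ennreal (C * mu_max\<^sup>2))"
proof -
  have net: "clustered_network nbhd clusters groups"
    and comb: "combination_matrix nbhd groups A"
    and cost: "cost_model clusters groups J wo lamL lamU kappaH"
    and tau: "\<And>k. 0 < tau k \<and> tau k \<le> 1"
    and noise: "\<And>mu_max. 0 < mu_max \<Longrightarrow>
           gradient_noise M (F mu_max) J wo ghat alpha sigma kappaS gammaS Rs"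
    and adapted: "\<And>mu_max i. 0 < mu_max \<Longrightarrow> w mu_max i \<in> borel_measurable (F mu_max i)"
    by fact+
  interpret diffusion_network nbhd clusters groups A J wo lamL lamU kappaH
    by (intro diffusion_network.intro grouped_network.intro net comb cost)
  obtain p where p: "\<And>k. 0 < p $ k" "A *v p = p"
    using stationary_weights by blast
  interpret stationary_diffusion nbhd clusters groups A p J wo lamL lamU kappaH
    by unfold_locales (use p in auto)
  obtain mu0 C where "0 < mu0" "0 < C"
    and bound: "\<And>mu_max. \<lbrakk>0 < mu_max; mu_max \<le> mu0\<rbrakk> \<Longrightarrow>
            limsup (\<lambda>i. \<integral>\<^sup>+\<omega>. ennreal (norm (err mu_max i \<omega>) ^ 2) \<partial>M) \<le> ennreal (C * mu_max)
          \<and> limsup (\<lambda>i. \<integral>\<^sup>+\<omega>. ennreal (norm (err mu_max i \<omega>) ^ 4) \<partial>M) \<le> ennreal (C * mu_max\<^sup>2)"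
  proof (rule mean_fourth_stability[OF tau, where alpha = alpha and sigma = sigma and 'a = 'a])
    fix mu0 C :: real
    assume "0 < mu0" "0 < C" and b: "\<And>mu (M :: 'a measure) F ghat kappaS gammaS Rs.
       \<lbrakk>0 < mu; mu \<le> mu0; gradient_noise M F J wo ghat alpha sigma kappaS gammaS Rs;
        \<And>i. net_iterate nbhd groups A (\<lambda>k. tau k * mu) ghat i \<in> borel_measurable (F i)\<rbrakk> \<Longrightarrow>
       limsup (\<lambda>i. \<integral>\<^sup>+\<omega>. ennreal (norm (net_error nbhd groups A (\<lambda>k. tau k * mu) ghat wo i \<omega>) ^ 2) \<partial>M)
         \<le> ennreal (C * mu) \<and>
       limsup (\<lambda>i. \<integral>\<^sup>+\<omega>. ennreal (norm (net_error nbhd groups A (\<lambda>k. tau k * mu) ghat wo i \<omega>) ^ 4) \<partial>M)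
         \<le> ennreal (C * mu\<^sup>2)"
    show thesis
    proof (rule that[OF \<open>0 < mu0\<close> \<open>0 < C\<close>])
      fix mu_max :: real
      assume mu: "0 < mu_max" "mu_max \<le> mu0"
      show "limsup (\<lambda>i. \<integral>\<^sup>+\<omega>. ennreal (norm (err mu_max i \<omega>) ^ 2) \<partial>M) \<le> ennreal (C * mu_max)
          \<and> limsup (\<lambda>i. \<integral>\<^sup>+\<omega>. ennreal (norm (err mu_max i \<omega>) ^ 4) \<partial>M) \<le> ennreal (C * mu_max\<^sup>2)"
        unfolding err_def mu_def
        by (rule b[OF mu noise[OF mu(1)] adapted[OF mu(1), unfolded w_def mu_def]])
    qed
  qed
  moreover have "err mu_max (Suc i) \<omega> =
      error_matrix A (mu mu_max) J wo (err mu_max i \<omega>) *v err mu_max i \<omega>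
      + (transpose (ext_combination A) ** ext_steps (mu mu_max)) *v grad_noise J ghat i \<omega> (w mu_max i \<omega>)"
    for mu_max i \<omega>
    unfolding err_def w_def by (rule net_error_recursion)
  ultimately show ?thesis by blast
qed

end
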